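(* Implement the definitions given in the context literally. For $(B,S,A)$ equal to $(20,1,\{0\})$, $(21,1,\{1\})$, $(25,1,\{0\})$, $(30,1,\{1\})$ and $(40,2,\{0,1\})$, and for $(a,q)\in\{(1,1),(1,2)\}$, the following hold. (i) For every odd prime $p$, $v_p\bigl(\prod_{i=0}^{N-1}\Pi_i\bigr)-v_p(F_D)=\sum_{\nu\ge1}a_{p^\nu,B}$. (ii) For every odd prime $p$, $v_p\bigl(q^S\det\mathcal R[A,J](a/q)\bigr)\ge\sum_{\nu\ge1}m^A_{p^\nu,B}$, where $q^S\det\mathcal R[A,J](a/q)$ is computed exactly. (iii) The quantity $$\mathcal B=\sum_{p\ \mathrm{odd\ prime},\ \nu\ge1}\bigl(a_{p^\nu,B}-m^A_{p^\nu,B}\bigr)\log p$$ takes, rounded to the displayed precision, the values $5912.1$, $6522.4$, $9304.5$, $13504.8$, $25030.7$ for the five triples $(B,S,A)$ in the order listed, and these values exceed the exact $\log\operatorname{den}\bigl(q^S\widehat q_B(a/q)\bigr)$ in every case. Thus the bound $\log H_B^{\min}\le\mathcal B$, where $H_B^{\min}=\operatorname{den}\bigl(q^S\widehat q_B(a/q)\bigr)$, is valid and nearly sharp in these instances.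
   Context: Logarithms are natural; $v_p$ is the $p$-adic valuation (with $v_p(0)=+\infty$); $\operatorname{den}(x)$ is the positive denominator of a rational $x$ in lowest terms. For integers $m\ge 0$ put $S_{m-1}=\sum_{k=0}^{m-1}\frac{(-1)^k}{(2k+1)^2}$ and $u_m(t)=\frac{(-1)^m(t-S_{m-1})}{2m+1}\in\mathbb Q[t]$. For integers $B>S>0$ let $\Pi_i=\prod_{h=1}^{B}\bigl(2(h+i)+1\bigr)^2$ ($i\ge0$), and for $0\le a\le S+2$, $1\le j\le S$ let $$\mathcal R_{a,j}(t)=\sum_{i=0}^{a+2B}(-1)^i\binom{a+2B}{i}\Pi_i\,u_{i+j}(t).$$ Put $J=\{1,\dots,S\}$, $D=2B$, $N=2B+S+3$, $F_D=\prod_{r=0}^{2B-1}r!$. For an $S$-element set $A\subset\{0,\dots,S+2\}$ write $\mathcal R[A,J](t)=(\mathcal R_{a,j}(t))_{a\in A,\,j\in J}$ and define (up to a sign, which is irrelevant here) $\widehat q_B(t)=\pm F_D\det\mathcal R[A,J](t)/\prod_{i=0}^{N-1}\Pi_i\in\mathbb Q[t]$. Here $t$ stands for the value of Catalan's constant; the evaluation $t=a/q$ corresponds to the hypothesis that this constant equals the rational $a/q$, and $H_B^{\min}$ is then the minimal positive integer $H$ with $q^SH\,\widehat q_B(a/q)\in\mathbb Z$. For an odd prime power $Q$ put $\Phi_Q(n)=\sum_{r=0}^{n-1}\lfloor r/Q\rfloor$, $N_{K,Q}(i)=\#\{1\le h\le K: Q\mid 2i+2h+1\}$, $C^A_Q=\sum_{a\in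 A}\lfloor(a+2B)/Q\rfloor$, $F_{N,Q}(i)=\lfloor i/Q\rfloor+\lfloor(N-1-i)/Q\rfloor$, and, for $I\subset\{0,\dots,N-1\}$, $n_{Q,r}(I)=\#\{i\in I:i\equiv r\pmod Q\}$. Define $$\lambda^A_Q(I)=C^A_Q+2\sum_{r\bmod Q}\binom{n_{Q,r}(I)}2+\sum_{i\in I}\Bigl(2N_{B,Q}(i)-N_{S,Q}(i)-2\cdot\mathbf 1_{Q\le2i+1}-F_{N,Q}(i)\Bigr),$$ $$m^A_{Q,B}=\min_{I\subset\{0,\dots,N-1\},\,|I|=S}\lambda^A_Q(I),\qquad a_{Q,B}=2\sum_{i=0}^{N-1}N_{B,Q}(i)-\Phi_Q(D),$$ where $\mathbf 1_{Q\le 2i+1}$ is $1$ if $Q\le2i+1$ and $0$ otherwise. *)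

theory Defs
  imports
    "HOL-Library.Extended_Real"
    "HOL-Analysis.Infinite_Sum"
    "HOL-Computational_Algebra.Computational_Algebra"
    "Jordan_Normal_Form.Determinant"
begin

definition vp :: "nat \<Rightarrow> rat \<Rightarrow> ereal" where
  "vp p x = (if x = 0 then \<infinity>
     else ereal (real (multiplicity (int p) (fst (quotient_of x)))
               - real (multiplicity (int p) (snd (quotient_of x)))))"

definition den :: "rat \<Rightarrow> int" where
  "den x = snd (quotient_of x)"


text \<open>Shifted index: \<open>catalan_sum m\<close> is the sum $S_{m-1}$ of the first \<open>m\<close> terms.\<close>

definition catalan_sum :: "nat \<Rightarrow> rat" where
  "catalan_sum m = (\<Sum>k<m. (-1) ^ k / (2 * of_nat k + 1) ^ 2)"

definition u_poly :: "nat \<Rightarrow> rat poly" where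
  "u_poly m = Polynomial.smult ((-1) ^ m / (2 * of_nat m + 1)) [:- catalan_sum m, 1:]"

definition Pi_fac :: "nat \<Rightarrow> nat \<Rightarrow> nat" where
  "Pi_fac B i = (\<Prod>h = 1..B. (2 * (h + i) + 1) ^ 2)"

definition R_entry :: "nat \<Rightarrow> nat \<Rightarrow> nat \<Rightarrow> rat poly" where
  "R_entry B a j =
     (\<Sum>i = 0..a + 2 * B.
        Polynomial.smult ((-1) ^ i * of_nat ((a + 2 * B) choose i) * of_nat (Pi_fac B i)) (u_poly (i + j)))"

text \<open>Rows are indexed by the elements of \<open>A\<close> in increasing order and columns by
  \<open>j = 1, \<dots>, S\<close>; matrix indices of the library start at 0.\<close>

definition R_mat :: "nat \<Rightarrow> nat \<Rightarrow> nat set \<Rightarrow> rat poly mat" where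
  "R_mat B S A = mat S S (\<lambda>(k, l). R_entry B (sorted_list_of_set A ! k) (l + 1))"

definition NN :: "nat \<Rightarrow> nat \<Rightarrow> nat" where
  "NN B S = 2 * B + S + 3"

definition F_fac :: "nat \<Rightarrow> nat" where
  "F_fac D = (\<Prod>r<D. fact r)"

definition Pi_prod :: "nat \<Rightarrow> nat \<Rightarrow> nat" where
  "Pi_prod B S = (\<Prod>i<NN B S. Pi_fac B i)"

text \<open>This polynomial is only specified up to sign; the sign \<open>+\<close> is chosen here. Denominators
  do not depend on this choice.\<close>

definition q_hat :: "nat \<Rightarrow> nat \<Rightarrow> nat set \<Rightarrow> rat poly" where
  "q_hat B S A = Polynomial.smult (of_nat (F_fac (2 * B)) / of_nat (Pi_prod B S)) (det (R_mat B S A))"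

definition H_min :: "nat \<Rightarrow> nat \<Rightarrow> nat set \<Rightarrow> int \<Rightarrow> int \<Rightarrow> nat" where
  "H_min B S A a q =
     (LEAST H. H > 0 \<and> of_int q ^ S * of_nat H * poly (q_hat B S A) (of_int a / of_int q) \<in> \<int>)"


definition Phi :: "nat \<Rightarrow> nat \<Rightarrow> nat" where
  "Phi Q n = (\<Sum>r<n. r div Q)"

definition Ncount :: "nat \<Rightarrow> nat \<Rightarrow> nat \<Rightarrow> nat" where
  "Ncount K Q i = card {h \<in> {1..K}. Q dvd 2 * i + 2 * h + 1}"

definition C_sum :: "nat \<Rightarrow> nat set \<Rightarrow> nat \<Rightarrow> nat" where
  "C_sum B A Q = (\<Sum>a\<in>A. (a + 2 * B) div Q)"

definition F_exp :: "nat \<Rightarrow> nat \<Rightarrow> nat \<Rightarrow> nat" where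
  "F_exp N Q i = i div Q + (N - 1 - i) div Q"

definition n_res :: "nat \<Rightarrow> nat \<Rightarrow> nat set \<Rightarrow> nat" where
  "n_res Q r I = card {i \<in> I. i mod Q = r}"

definition lam :: "nat \<Rightarrow> nat \<Rightarrow> nat set \<Rightarrow> nat \<Rightarrow> nat set \<Rightarrow> int" where
  "lam B S A Q I =
     int (C_sum B A Q)
     + 2 * (\<Sum>r<Q. int (n_res Q r I choose 2))
     + (\<Sum>i\<in>I. 2 * int (Ncount B Q i) - int (Ncount S Q i)
          - 2 * (if Q \<le> 2 * i + 1 then 1 else 0) - int (F_exp (NN B S) Q i))"

definition m_exp :: "nat \<Rightarrow> nat \<Rightarrow> nat set \<Rightarrow> nat \<Rightarrow> int" where
  "m_exp B S A Q = Min (lam B S A Q ` {I. I \<subseteq> {..<NN B S} \<and> card I = S})"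

definition a_exp :: "nat \<Rightarrow> nat \<Rightarrow> nat \<Rightarrow> int" where
  "a_exp B S Q = 2 * (\<Sum>i<NN B S. int (Ncount B Q i)) - int (Phi Q (2 * B))"

definition a_total :: "nat \<Rightarrow> nat \<Rightarrow> nat \<Rightarrow> real" where
  "a_total B S p = (\<Sum>\<^sub>\<infinity>\<nu>\<in>{1..}. real_of_int (a_exp B S (p ^ \<nu>)))"

definition m_total :: "nat \<Rightarrow> nat \<Rightarrow> nat set \<Rightarrow> nat \<Rightarrow> real" where
  "m_total B S A p = (\<Sum>\<^sub>\<infinity>\<nu>\<in>{1..}. real_of_int (m_exp B S A (p ^ \<nu>)))"

definition B_bound :: "nat \<Rightarrow> nat \<Rightarrow> nat set \<Rightarrow> real" where
  "B_bound B S A =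
     (\<Sum>\<^sub>\<infinity>(p, \<nu>)\<in>{(p, \<nu>). prime p \<and> odd p \<and> \<nu> \<ge> 1}.
        real_of_int (a_exp B S (p ^ \<nu>) - m_exp B S A (p ^ \<nu>)) * ln (real p))"


text \<open>The infinite sums above have finite support, so that \<open>infsum\<close> never falls back to its
  default value 0 for sums that do not converge.\<close>

lemma Ncount_eq_0:
  assumes "2 * i + 2 * K + 1 < Q"
  shows "Ncount K Q i = 0"
proof -
  have "{h \<in> {1..K}. Q dvd 2 * i + 2 * h + 1} = {}"
    using assms by (auto dest!: dvd_imp_le)
  then show ?thesis
    unfolding Ncount_def by simp
qed

lemma a_exp_eq_0:
  assumes "2 * (NN B S + B) < Q"
  shows "a_exp B S Q = 0"
proof -
  have "(\<Sum>i<NN B S. int (Ncount B Q i)) = 0"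
    using assms by (intro sum.neutral ballI) (simp add: Ncount_eq_0)
  moreover have "Phi Q (2 * B) = 0"
    unfolding Phi_def using assms by (intro sum.neutral ballI) (auto simp: NN_def)
  ultimately show ?thesis
    by (simp add: a_exp_def)
qed

lemma lam_eq_0:
  assumes Q: "2 * (NN B S + B) < Q" and "S \<le> B" and A: "A \<subseteq> {0..S + 2}" and I: "I \<subseteq> {..<NN B S}"
  shows "lam B S A Q I = 0"
proof -
  have "C_sum B A Q = 0"
    unfolding C_sum_def using A Q by (intro sum.neutral ballI) (auto simp: NN_def)
  moreover have "(\<Sum>r<Q. int (n_res Q r I choose 2)) = 0"
  proof (intro sum.neutral ballI)
    fix r
    have "{i \<in> I. i mod Q = r} \<subseteq> {r}"
    proof
      fix i
      assume i: "i \<in> {i \<in> I. i mod Q = r}"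
      then have "i < Q" using I Q by auto
      then show "i \<in> {r}" using i by simp
    qed
    then have "n_res Q r I \<le> 1"
      unfolding n_res_def using card_mono[of "{r}"] by fastforce
    then show "int (n_res Q r I choose 2) = 0"
      by (simp add: binomial_eq_0)
  qed
  moreover have "(\<Sum>i\<in>I. 2 * int (Ncount B Q i) - int (Ncount S Q i)
      - 2 * (if Q \<le> 2 * i + 1 then 1 else 0) - int (F_exp (NN B S) Q i)) = 0"
  proof (intro sum.neutral ballI)
    fix i
    assume "i \<in> I"
    then have i: "i < NN B S" using I by auto
    have "Ncount B Q i = 0" "Ncount S Q i = 0"
      using i assms(1,2) by (auto intro!: Ncount_eq_0)
    moreover have "\<not> Q \<le> 2 * i + 1" "F_exp (NN B S) Q i = 0"
      using i Q by (auto simp: F_exp_def)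
    ultimately show "2 * int (Ncount B Q i) - int (Ncount S Q i)
      - 2 * (if Q \<le> 2 * i + 1 then 1 else 0) - int (F_exp (NN B S) Q i) = 0"
      by simp
  qed
  ultimately show ?thesis
    unfolding lam_def by simp
qed

lemma m_exp_eq_0:
  assumes "2 * (NN B S + B) < Q" and "S \<le> B" and "A \<subseteq> {0..S + 2}"
  shows "m_exp B S A Q = 0"
proof -
  have mem: "{..<S} \<in> {I. I \<subseteq> {..<NN B S} \<and> card I = S}"
    by (auto simp: NN_def)
  have "lam B S A Q ` {I. I \<subseteq> {..<NN B S} \<and> card I = S} = (\<lambda>_. 0) ` {I. I \<subseteq> {..<NN B S} \<and> card I = S}"
    by (intro image_cong refl) (simp add: lam_eq_0[OF assms])
  also have "\<dots> = {0}"
    using mem by (intro image_constant)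
  finally show ?thesis
    unfolding m_exp_def by simp
qed

lemma less_prime_power:
  assumes "prime (p :: nat)" and "M \<le> \<nu>"
  shows "M < p ^ \<nu>"
proof -
  have "\<nu> < p ^ \<nu>"
    using power_gt_expt[of p \<nu>] prime_gt_1_nat[OF assms(1)] by simp
  then show ?thesis
    using assms(2) by simp
qed

lemma a_exp_summable:
  assumes "prime p"
  shows "(\<lambda>\<nu>. real_of_int (a_exp B S (p ^ \<nu>))) summable_on {1..}"
proof (rule finite_nonzero_values_imp_summable_on)
  show "finite {\<nu> \<in> {1..}. real_of_int (a_exp B S (p ^ \<nu>)) \<noteq> 0}"
  proof (rule finite_subset)
    show "{\<nu> \<in> {1..}. real_of_int (a_exp B S (p ^ \<nu>)) \<noteq> 0} \<subseteq> {..2 * (NN B S + B)}"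
      using a_exp_eq_0[OF less_prime_power[OF assms]] by (auto intro: leI)
  qed simp
qed

lemma m_exp_summable:
  assumes "prime p" and "S \<le> B" and "A \<subseteq> {0..S + 2}"
  shows "(\<lambda>\<nu>. real_of_int (m_exp B S A (p ^ \<nu>))) summable_on {1..}"
proof (rule finite_nonzero_values_imp_summable_on)
  show "finite {\<nu> \<in> {1..}. real_of_int (m_exp B S A (p ^ \<nu>)) \<noteq> 0}"
  proof (rule finite_subset)
    show "{\<nu> \<in> {1..}. real_of_int (m_exp B S A (p ^ \<nu>)) \<noteq> 0} \<subseteq> {..2 * (NN B S + B)}"
      using m_exp_eq_0[OF less_prime_power[OF assms(1)] assms(2,3)] by (auto intro: leI)
  qed simp
qed

lemma B_bound_summable:
  assumes "S \<le> B" and "A \<subseteq> {0..S + 2}"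
  shows "(\<lambda>(p, \<nu>). real_of_int (a_exp B S (p ^ \<nu>) - m_exp B S A (p ^ \<nu>)) * ln (real p))
           summable_on {(p, \<nu>). prime p \<and> odd p \<and> \<nu> \<ge> 1}"
    (is "?f summable_on ?X")
proof (rule finite_nonzero_values_imp_summable_on)
  let ?M = "2 * (NN B S + B)"
  have "x \<in> {..?M} \<times> {..?M}" if x: "x \<in> ?X" "?f x \<noteq> 0" for x
  proof (rule ccontr)
    assume not_mem: "x \<notin> {..?M} \<times> {..?M}"
    obtain p \<nu> where x_eq: "x = (p, \<nu>)" by (cases x)
    have p: "prime p" and \<nu>: "\<nu> \<ge> 1" and large: "p > ?M \<or> \<nu> > ?M"
      using x(1) not_mem by (auto simp: x_eq)
    have "p \<le> p ^ \<nu>"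
      using \<nu> prime_gt_0_nat[OF p] by (intro self_le_power) auto
    then have "?M < p ^ \<nu>"
      using large less_prime_power[OF p, of ?M \<nu>] by linarith
    then show False
      using x(2) a_exp_eq_0[of B S "p ^ \<nu>"] m_exp_eq_0[OF _ assms, of "p ^ \<nu>"] by (simp add: x_eq)
  qed
  then have "{x \<in> ?X. ?f x \<noteq> 0} \<subseteq> {..?M} \<times> {..?M}"
    by blast
  then show "finite {x \<in> ?X. ?f x \<noteq> 0}"
    by (rule finite_subset) simp
qed

end

theory Submission
  imports Defs "HOL-Analysis.Harmonic_Numbers"
begin

text \<open>
  All three claims concern finitely many small primes. Every integer whose valuation matters, apart
  from products of such integers, is at most \<open>250\<close>, and \<open>250 < 3 ^ 6\<close>; hence only the prime
  powers \<open>p ^ \<nu>\<close> with \<open>p \<le> 250\<close> and \<open>\<nu> \<le> 5\<close> contribute to any of the sums over \<open>\<nu>\<close>.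

  Part (i) is Legendre's formula: \<open>v\<^sub>p(n)\<close> counts the \<open>\<nu>\<close> with \<open>p ^ \<nu>\<close> dividing \<open>n\<close>, so the
  valuations of a product of odd numbers and of a factorial are sums over the levels \<open>\<nu>\<close> of counts of
  multiples of \<open>p ^ \<nu>\<close> (\<open>vp_Pi_prod_minus_vp_F_fac\<close>).

  Part (ii) is proved summand by summand, without evaluating any determinant. In
  \<open>q \<R>\<^sub>a\<^sub>,\<^sub>j(a/q)\<close> the summand with index \<open>i\<close> is a binomial coefficient times \<open>\<Pi>\<^sub>i\<close> times
  \<open>(a - q S\<^sub>i\<^sub>+\<^sub>j\<^sub>-\<^sub>1) / (2(i+j)+1)\<close>, and the denominator of \<open>S\<^sub>m\<^sub>-\<^sub>1\<close> divides the square of the least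
  common multiple of \<open>1, 3, \<dots>, 2m-1\<close>. This gives a lower bound \<open>term_exp\<close> at each level.
  For \<open>S = 1\<close> it is at least \<open>\<lambda>({i})\<close> (\<open>m_exp_le_term_exp\<close>). For the instance with \<open>S = 2\<close> it
  is enough to bound both products in the expansion of the determinant, by the minima of \<open>term_exp\<close>
  over the two rows; this gives the claim at every prime except \<open>41\<close>. At
  \<open>41\<close> the crude bound loses one unit, since two indices congruent modulo \<open>41\<close> dominate both rows;
  replacing the second row by itself minus twice the first one cancels
  these contributions modulo \<open>41\<close> (\<open>padic_ge_det_pair_41\<close>).

  Parts (i) and (ii) show that the denominator of \<open>q\<^sup>S q\<^sub>B(a/q)\<close>, the polynomial being the normalised
  determinant, divides the product of \<open>p ^ e(p)\<close>, where \<open>e(p)\<close> is the coefficient of \<open>log p\<close> in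
  the bound \<open>\<B>\<close> of part (iii); no power of \<open>2\<close> occurs, because all entries are \<open>2\<close>-integral and the
  \<open>\<Pi>\<^sub>i\<close> are odd. In each instance there is moreover a prime
  \<open>p\<^sub>0\<close> at which the termwise bound exceeds the minimum \<open>m\<close> by at least one, so that the exponent of \<open>p\<^sub>0\<close>
  may be lowered. The logarithm of the denominator is therefore at most \<open>\<B> - log p\<^sub>0 \<le> \<B> - 1\<close>
  (\<open>ln_den_q_hat_le\<close>), which settles both strict inequalities, even where the
  rounded value of \<open>\<B>\<close> is smaller than \<open>\<B>\<close>.

  It remains to evaluate \<open>\<B>\<close>. The integers \<open>e(p)\<close> are computed exactly after the minimum over all
  \<open>S\<close>-element sets has been replaced by a minimum over single indices: for \<open>S = 2\<close> an optimal pair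
  can be chosen greedily (\<open>m_exp_pair\<close>). The logarithms come from the \<open>artanh\<close> series for
  \<open>ln (n / (n - 1))\<close> in fixed-point arithmetic, with enough precision to decide the rounding.
\<close>

section \<open>Lower bounds for p-adic valuations\<close>

text \<open>
  A one-sided formulation of \<open>v\<^sub>p(x) \<ge> k\<close>: unlike the valuation itself it needs no case
  distinction at \<open>x = 0\<close> and is closed under sums and products.
\<close>
definition padic_ge :: "nat \<Rightarrow> int \<Rightarrow> rat \<Rightarrow> bool" where
  "padic_ge p k x \<longleftrightarrow>
     (\<exists>y d :: int. \<not> int p dvd d \<and> x = of_int y / of_int d * of_nat p powi k)"

lemma padic_ge_mono:
  assumes "padic_ge p k x" "l \<le> k" "prime p"
  shows "padic_ge p l x"
proof -
  obtain y d where yd: "\<not> int p dvd d" "x = of_int y / of_int d * of_nat p powi k"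
    using assms(1) by (auto simp: padic_ge_def)
  have p0: "(of_nat p :: rat) \<noteq> 0" using assms(3) prime_gt_0_nat by auto
  have "(of_nat p :: rat) powi k = of_nat p powi l * of_nat p powi (k - l)"
    using p0 by (simp flip: power_int_add)
  also have "(of_nat p :: rat) powi (k - l) = of_int (int p ^ nat (k - l))"
    using assms(2) by (simp add: power_int_def)
  finally have "x = of_int (y * int p ^ nat (k - l)) / of_int d * of_nat p powi l"
    by (simp add: yd(2) mult_ac)
  then show ?thesis using yd(1) unfolding padic_ge_def by blast
qed

lemma padic_ge_add:
  assumes "padic_ge p k x" "padic_ge p k y" "prime p"
  shows "padic_ge p k (x + y)"
proof -
  obtain a d where 1: "\<not> int p dvd d" "x = of_int a / of_int d * of_nat p powi k"
    using assms(1) by (auto simp: padic_ge_def)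
  obtain b e where 2: "\<not> int p dvd e" "y = of_int b / of_int e * of_nat p powi k"
    using assms(2) by (auto simp: padic_ge_def)
  have "d \<noteq> 0" "e \<noteq> 0" using 1(1) 2(1) by auto
  then have "x + y = of_int (a * e + b * d) / of_int (d * e) * of_nat p powi k"
    by (simp add: 1(2) 2(2) field_simps)
  moreover have "\<not> int p dvd d * e"
    using 1(1) 2(1) assms(3) by (simp add: prime_dvd_mult_iff)
  ultimately show ?thesis unfolding padic_ge_def by blast
qed

lemma padic_ge_mult:
  assumes "padic_ge p k x" "padic_ge p l y" "prime p"
  shows "padic_ge p (k + l) (x * y)"
proof -
  obtain a d where 1: "\<not> int p dvd d" "x = of_int a / of_int d * of_nat p powi k"
    using assms(1) by (auto simp: padic_ge_def)
  obtain b e where 2: "\<not> int p dvd e" "y = of_int b / of_int e * of_nat p powi l"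
    using assms(2) by (auto simp: padic_ge_def)
  have "(of_nat p :: rat) \<noteq> 0" using assms(3) prime_gt_0_nat by auto
  then have "x * y = of_int (a * b) / of_int (d * e) * of_nat p powi (k + l)"
    by (simp add: 1(2) 2(2) power_int_add)
  moreover have "\<not> int p dvd d * e"
    using 1(1) 2(1) assms(3) by (simp add: prime_dvd_mult_iff)
  ultimately show ?thesis unfolding padic_ge_def by blast
qed

lemma padic_ge_of_int_power:
  assumes "int p ^ k dvd n" "prime p"
  shows "padic_ge p (int k) (of_int n)"
proof -
  obtain y where "n = int p ^ k * y" using assms(1) by (elim dvdE)
  then have "of_int n = of_int y / of_int 1 * (of_nat p :: rat) powi int k"
    by (simp add: mult.commute)
  moreover have "\<not> int p dvd 1"
    using prime_gt_1_nat[OF assms(2)] by simp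
  ultimately show ?thesis unfolding padic_ge_def by blast
qed

lemma padic_ge_of_int: "prime p \<Longrightarrow> padic_ge p 0 (of_int n)"
  using padic_ge_of_int_power[of p 0 n] by simp

lemma padic_ge_zero: "prime p \<Longrightarrow> padic_ge p k 0"
  unfolding padic_ge_def
  by (intro exI[of _ 0] exI[of _ 1]) (auto dest: prime_gt_1_nat)

lemma padic_ge_sum:
  assumes "\<And>i. i \<in> I \<Longrightarrow> padic_ge p k (f i)" "prime p"
  shows "padic_ge p k (\<Sum>i\<in>I. f i)"
  using assms by (induction I rule: infinite_finite_induct) (auto simp: padic_ge_zero padic_ge_add)

lemma padic_ge_diff:
  assumes "padic_ge p k x" "padic_ge p k y" "prime p"
  shows "padic_ge p k (x - y)"
proof -
  have "padic_ge p k (of_int (- 1) * y)"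
    using padic_ge_mult[OF padic_ge_of_int[OF assms(3)] assms(2,3), of "- 1"] by simp
  then show ?thesis using padic_ge_add[OF assms(1) _ assms(3)] by fastforce
qed

lemma padic_ge_of_nat:
  assumes "k \<le> multiplicity p n" "prime p"
  shows "padic_ge p (int k) (of_nat n)"
proof -
  have "p ^ k dvd n" using assms(1) multiplicity_dvd' by blast
  then have "int (p ^ k) dvd int n" by (rule of_nat_dvd_iff[THEN iffD2])
  then show ?thesis using padic_ge_of_int_power[of p k "int n"] assms(2) by simp
qed

lemma padic_ge_inverse:
  assumes "n > 0" "multiplicity p n \<le> k" "prime p"
  shows "padic_ge p (- int k) (1 / of_nat n)"
proof -
  obtain d where d: "n = p ^ multiplicity p n * d" "\<not> p dvd d"
    using assms(1,3) by (elim multiplicity_decompose'[of n p, rotated 2]) auto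
  have "d \<noteq> 0" using d(2) by (metis dvd_0_right)
  have p0: "(of_nat p :: rat) \<noteq> 0" using assms(3) prime_gt_0_nat by auto
  have "(of_nat n :: rat) = of_nat p ^ multiplicity p n * of_nat d"
    by (subst d(1)) simp
  then have "1 / of_nat n = of_int 1 / of_int (int d) * (of_nat p :: rat) powi (- int (multiplicity p n))"
    using p0 \<open>d \<noteq> 0\<close> by (simp add: power_int_minus field_simps)
  moreover have "\<not> int p dvd int d" using d(2) by simp
  ultimately have "padic_ge p (- int (multiplicity p n)) (1 / of_nat n)"
    unfolding padic_ge_def by blast
  then show ?thesis using assms(2,3) by (elim padic_ge_mono) auto
qed

text \<open>
  Clearing denominators turns the representation of \<open>x\<close> into an identity between integers, on both
  sides of which the multiplicity of \<open>p\<close> can be read off.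
\<close>
lemma vp_ge:
  assumes "padic_ge p k x" "prime p"
  shows "vp p x \<ge> ereal (of_int k)"
proof (cases "x = 0")
  case True
  then show ?thesis by (simp add: vp_def)
next
  case False
  obtain y d where yd: "\<not> int p dvd d" "x = of_int y / of_int d * of_nat p powi k"
    using assms(1) by (auto simp: padic_ge_def)
  obtain n m where nm: "quotient_of x = (n, m)" by fastforce
  have m: "m > 0" using quotient_of_denom_pos[OF nm] .
  have x: "x = of_int n / of_int m" using quotient_of_div[OF nm] .
  have n: "n \<noteq> 0" using x False by auto
  have d0: "d \<noteq> 0" "y \<noteq> 0" using yd False by auto
  have pp: "prime (int p)" "prime_elem (int p)" using assms(2) by simp_all
  have p0: "(of_nat p :: rat) \<noteq> 0" "int p \<noteq> 0" using assms(2) prime_gt_0_nat by auto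
  let ?v = "multiplicity (int p)"
  have vd: "?v d = 0" using yd(1) by (rule not_dvd_imp_multiplicity_0)
  have split: "(of_nat p :: rat) powi k * of_int (int p ^ nat (- k)) = of_int (int p ^ nat k)"
    using p0 by (auto simp: power_int_def field_simps)
  have "of_int (n * d * int p ^ nat (- k)) = (of_int (y * m * int p ^ nat k) :: rat)"
  proof -
    have "of_int (n * d) = (of_int (y * m) * of_nat p powi k :: rat)"
      using yd(2) x m d0 by (simp add: field_simps)
    then have "of_int (n * d * int p ^ nat (- k)) = of_int (y * m) * ((of_nat p :: rat) powi k * of_int (int p ^ nat (- k)))"
      by simp
    then show ?thesis unfolding split by simp
  qed
  then have "n * d * int p ^ nat (- k) = y * m * int p ^ nat k" by (simp only: of_int_eq_iff)
  then have "?v (n * d * int p ^ nat (- k)) = ?v (y * m * int p ^ nat k)" by simp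
  then have "?v n + nat (- k) = ?v y + ?v m + nat k"
    using n m d0 p0 pp vd by (simp add: prime_elem_multiplicity_mult_distrib)
  then have "int (?v n) - int (?v m) \<ge> k" by linarith
  then have "real (?v n) - real (?v m) \<ge> of_int k" by linarith
  then show ?thesis using False by (simp add: vp_def nm)
qed

text \<open>
  Either \<open>p\<close> does not divide the denominator, or it does not divide the numerator and the
  valuation is minus the multiplicity in the denominator.
\<close>
lemma multiplicity_den_le:
  assumes "padic_ge p (- int k) x" "prime p"
  shows "multiplicity (int p) (den x) \<le> k"
proof (cases "int p dvd den x")
  case False
  then show ?thesis by (simp add: not_dvd_imp_multiplicity_0)
next
  case True
  obtain n m where nm: "quotient_of x = (n, m)" by fastforce
  have "coprime n m" using quotient_of_coprime[OF nm] .
  then have "\<not> int p dvd n"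
    using True nm assms(2) unfolding den_def
    by (metis coprime_common_divisor not_prime_unit prime_nat_int_transfer snd_conv)
  then have 0: "multiplicity (int p) n = 0" by (rule not_dvd_imp_multiplicity_0)
  have "x \<noteq> 0" using True prime_gt_1_nat[OF assms(2)] by (auto simp: den_def)
  with vp_ge[OF assms] nm 0 show ?thesis by (simp add: vp_def den_def)
qed

text \<open>
  The two factors \<open>q\<close> are shared out between the rows: each clears the denominator of the argument
  \<open>a/q\<close> in one row.
\<close>
lemma padic_ge_2x2:
  fixes q :: int
  assumes "prime p"
    and "padic_ge p k\<^sub>0\<^sub>1 (of_int q * x\<^sub>0\<^sub>1)" "padic_ge p k\<^sub>0\<^sub>2 (of_int q * x\<^sub>0\<^sub>2)"
    and "padic_ge p k\<^sub>1\<^sub>1 (of_int q * x\<^sub>1\<^sub>1)" "padic_ge p k\<^sub>1\<^sub>2 (of_int q * x\<^sub>1\<^sub>2)"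
    and "k \<le> k\<^sub>0\<^sub>1 + k\<^sub>1\<^sub>2" "k \<le> k\<^sub>0\<^sub>2 + k\<^sub>1\<^sub>1"
  shows "padic_ge p k (of_int q ^ 2 * (x\<^sub>0\<^sub>1 * x\<^sub>1\<^sub>2 - x\<^sub>0\<^sub>2 * x\<^sub>1\<^sub>1))"
proof -
  have "padic_ge p k ((of_int q * x\<^sub>0\<^sub>1) * (of_int q * x\<^sub>1\<^sub>2) - (of_int q * x\<^sub>0\<^sub>2) * (of_int q * x\<^sub>1\<^sub>1))"
    using padic_ge_mono[OF padic_ge_mult[OF assms(2,5,1)] assms(6,1)]
      padic_ge_mono[OF padic_ge_mult[OF assms(3,4,1)] assms(7,1)] assms(1)
    by (rule padic_ge_diff)
  then show ?thesis by (simp add: power2_eq_square algebra_simps)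
qed

section \<open>Valuations of factorials and of products of odd numbers\<close>

text \<open>
  The levels \<open>\<nu>\<close> with \<open>p ^ \<nu>\<close> dividing \<open>n\<close> form an initial segment, whose length is the
  multiplicity. The cutoff \<open>K\<close> is kept explicit so that all later sums run over the same levels.
\<close>
lemma multiplicity_eq_sum_dvd:
  fixes n p K :: nat
  assumes "prime p" "n > 0" "n < p ^ Suc K"
  shows "multiplicity p n = (\<Sum>\<nu> = 1..K. if p ^ \<nu> dvd n then 1 else 0)"
proof -
  have le: "multiplicity p n \<le> K"
  proof (rule ccontr)
    assume "\<not> multiplicity p n \<le> K"
    then have "p ^ Suc K dvd n" by (intro multiplicity_dvd') simp
    then show False using dvd_imp_le assms(2,3) by fastforce
  qed
  have "(\<Sum>\<nu> = 1..K. if p ^ \<nu> dvd n then 1 else 0) = card {\<nu> \<in> {1..K}. p ^ \<nu> dvd n}"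
    by (simp add: sum.If_cases Int_def)
  also have "{\<nu> \<in> {1..K}. p ^ \<nu> dvd n} = {1..multiplicity p n}"
    using assms(1,2) le prime_gt_1_nat[OF assms(1)]
    by (auto simp: power_dvd_iff_le_multiplicity)
  finally show ?thesis by simp
qed

lemma multiplicity_fact:
  fixes n p K :: nat
  assumes "prime p" "n < p ^ Suc K"
  shows "multiplicity p (fact n :: nat) = (\<Sum>\<nu> = 1..K. n div p ^ \<nu>)"
  using assms(2)
proof (induction n)
  case (Suc n)
  have "multiplicity p (fact (Suc n) :: nat) = multiplicity p (Suc n) + multiplicity p (fact n :: nat)"
    using assms(1) unfolding fact_Suc of_nat_id
    by (intro prime_elem_multiplicity_mult_distrib) auto
  also have "\<dots> = (\<Sum>\<nu> = 1..K. (if p ^ \<nu> dvd Suc n then 1 else 0) + n div p ^ \<nu>)"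
    using Suc assms(1) by (simp only: sum.distrib multiplicity_eq_sum_dvd[of p "Suc n" K] zero_less_Suc Suc_lessD)
  also have "\<dots> = (\<Sum>\<nu> = 1..K. Suc n div p ^ \<nu>)"
    by (intro sum.cong refl) (simp add: div_Suc dvd_eq_mod_eq_0)
  finally show ?case .
qed simp

lemma multiplicity_binomial:
  fixes n i p K :: nat
  assumes "prime p" "n < p ^ Suc K" "i \<le> n"
  shows "int (multiplicity p (n choose i)) =
    (\<Sum>\<nu> = 1..K. int (n div p ^ \<nu>) - int (i div p ^ \<nu>) - int ((n - i) div p ^ \<nu>))"
proof -
  have "multiplicity p (fact n :: nat) = multiplicity p (fact i * fact (n - i) * (n choose i))"
    using binomial_fact_lemma[OF assms(3)] by simp
  also have "\<dots> = multiplicity p (fact i :: nat) + multiplicity p (fact (n - i) :: nat) + multiplicity p (n choose i)"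
    using assms by (simp add: prime_elem_multiplicity_mult_distrib zero_less_binomial)
  finally have "int (multiplicity p (n choose i)) = int (multiplicity p (fact n :: nat))
      - int (multiplicity p (fact i :: nat)) - int (multiplicity p (fact (n - i) :: nat))"
    by simp
  moreover have "multiplicity p (fact n :: nat) = (\<Sum>\<nu> = 1..K. n div p ^ \<nu>)"
    "multiplicity p (fact i :: nat) = (\<Sum>\<nu> = 1..K. i div p ^ \<nu>)"
    "multiplicity p (fact (n - i) :: nat) = (\<Sum>\<nu> = 1..K. (n - i) div p ^ \<nu>)"
    using assms by (intro multiplicity_fact; simp)+
  ultimately show ?thesis by (simp add: sum_subtractf)
qed

text \<open>
  Exchanging the sum over the factors with the sum over the levels turns the divisibility
  indicators into the counting function of the statement.
\<close>
lemma multiplicity_Pi_fac: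
  assumes "prime p" "2 * (B + i) + 1 < p ^ Suc K"
  shows "multiplicity p (Pi_fac B i) = 2 * (\<Sum>\<nu> = 1..K. Ncount B (p ^ \<nu>) i)"
proof -
  have "multiplicity p (Pi_fac B i) = (\<Sum>h = 1..B. 2 * multiplicity p (2 * (h + i) + 1))"
    using assms(1) unfolding Pi_fac_def
    by (subst prime_elem_multiplicity_prod_distrib)
       (auto simp: prime_elem_multiplicity_power_distrib simp del: mult_Suc_right)
  also have "\<dots> = (\<Sum>h = 1..B. 2 * (\<Sum>\<nu> = 1..K. if p ^ \<nu> dvd 2 * (h + i) + 1 then 1 else 0))"
    using assms by (intro sum.cong refl arg_cong2[where f = "(*)"] multiplicity_eq_sum_dvd) auto
  also have "\<dots> = 2 * (\<Sum>\<nu> = 1..K. \<Sum>h = 1..B. if p ^ \<nu> dvd 2 * (h + i) + 1 then 1 else 0)"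
    by (subst sum.swap) (simp add: sum_distrib_left)
  also have "(\<Sum>\<nu> = 1..K. \<Sum>h = 1..B. if p ^ \<nu> dvd 2 * (h + i) + 1 then 1 else 0)
      = (\<Sum>\<nu> = 1..K. Ncount B (p ^ \<nu>) i)"
    by (intro sum.cong refl) (simp add: Ncount_def sum.If_cases Int_def algebra_simps)
  finally show ?thesis .
qed

lemma multiplicity_Pi_prod:
  assumes "prime p" "2 * (NN B S + B) < p ^ Suc K"
  shows "multiplicity p (Pi_prod B S) = 2 * (\<Sum>\<nu> = 1..K. \<Sum>i<NN B S. Ncount B (p ^ \<nu>) i)"
proof -
  have "multiplicity p (Pi_prod B S) = (\<Sum>i<NN B S. multiplicity p (Pi_fac B i))"
    using assms(1) unfolding Pi_prod_def
    by (subst prime_elem_multiplicity_prod_distrib) (auto simp: Pi_fac_def)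
  also have "\<dots> = (\<Sum>i<NN B S. 2 * (\<Sum>\<nu> = 1..K. Ncount B (p ^ \<nu>) i))"
    using assms by (intro sum.cong refl multiplicity_Pi_fac) auto
  also have "\<dots> = 2 * (\<Sum>\<nu> = 1..K. \<Sum>i<NN B S. Ncount B (p ^ \<nu>) i)"
    by (subst sum.swap) (simp add: sum_distrib_left)
  finally show ?thesis .
qed

lemma multiplicity_F_fac:
  assumes "prime p" "D \<le> p ^ Suc K"
  shows "multiplicity p (F_fac D) = (\<Sum>\<nu> = 1..K. Phi (p ^ \<nu>) D)"
proof -
  have "multiplicity p (F_fac D) = (\<Sum>r<D. multiplicity p (fact r :: nat))"
    using assms(1) unfolding F_fac_def by (subst prime_elem_multiplicity_prod_distrib) auto
  also have "\<dots> = (\<Sum>r<D. \<Sum>\<nu> = 1..K. r div p ^ \<nu>)"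
    using assms by (intro sum.cong refl multiplicity_fact) auto
  also have "\<dots> = (\<Sum>\<nu> = 1..K. Phi (p ^ \<nu>) D)"
    by (subst sum.swap) (simp add: Phi_def)
  finally show ?thesis .
qed

lemma Pi_prod_pos: "Pi_prod B S > 0"
  by (simp add: Pi_prod_def Pi_fac_def prod_pos)

lemma F_fac_pos: "F_fac D > 0"
  by (simp add: F_fac_def prod_pos)

lemma sum_a_exp:
  assumes "prime p" "2 * (NN B S + B) < p ^ Suc K"
  shows "(\<Sum>\<nu> = 1..K. a_exp B S (p ^ \<nu>)) =
    int (multiplicity p (Pi_prod B S)) - int (multiplicity p (F_fac (2 * B)))"
proof -
  have "2 * B \<le> 2 * (NN B S + B)" by simp
  also note assms(2)
  finally have "2 * B \<le> p ^ Suc K" by (rule less_imp_le)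
  note * = multiplicity_Pi_prod[OF assms] multiplicity_F_fac[OF assms(1) this]
  show ?thesis
    unfolding * a_exp_def by (simp add: sum_subtractf sum_distrib_left)
qed

text \<open>
  Reduces the infinite sums over \<open>\<nu>\<close> to the levels at which \<open>p ^ \<nu>\<close> does not exceed the
  support of \<open>f\<close>.
\<close>
lemma infsum_prime_powers:
  fixes f :: "nat \<Rightarrow> int"
  assumes "prime p" "M < p ^ Suc K" "\<And>Q. M < Q \<Longrightarrow> f Q = 0"
  shows "(\<Sum>\<^sub>\<infinity>\<nu>\<in>{1..}. real_of_int (f (p ^ \<nu>))) = of_int (\<Sum>\<nu> = 1..K. f (p ^ \<nu>))"
proof -
  have "f (p ^ \<nu>) = 0" if "\<nu> \<ge> Suc K" for \<nu>
    using assms(2) power_increasing[OF that, of p] prime_gt_0_nat[OF assms(1)] by (intro assms(3)) simp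
  then have "(\<Sum>\<^sub>\<infinity>\<nu>\<in>{1..}. real_of_int (f (p ^ \<nu>))) = (\<Sum>\<^sub>\<infinity>\<nu>\<in>{1..K}. real_of_int (f (p ^ \<nu>)))"
    by (intro infsum_cong_neutral) (auto simp: not_le)
  then show ?thesis by simp
qed

lemma multiplicity_int:
  assumes "prime p" "n > 0"
  shows "multiplicity (int p) (int n) = multiplicity p n"
proof (rule multiplicity_eqI)
  have "p ^ multiplicity p n dvd n" by (rule multiplicity_dvd)
  then show "int p ^ multiplicity p n dvd int n"
    by (simp flip: of_nat_power)
  have "\<not> p ^ Suc (multiplicity p n) dvd n"
    using assms by (subst power_dvd_iff_le_multiplicity) auto
  then show "\<not> int p ^ Suc (multiplicity p n) dvd int n"
    by (simp only: of_nat_power [symmetric] of_nat_dvd_iff not_False_eq_True)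
qed

lemma vp_of_nat:
  assumes "prime p" "n > 0"
  shows "vp p (of_nat n) = ereal (real (multiplicity p n))"
proof -
  have "quotient_of (of_nat n) = (int n, 1)"
    using quotient_of_int[of "int n"] by simp
  then show ?thesis using assms by (simp add: vp_def multiplicity_int)
qed

lemma vp_Pi_prod_minus_vp_F_fac:
  assumes "prime p" "2 * (NN B S + B) < p ^ Suc K"
  shows "vp p (of_nat (Pi_prod B S)) - vp p (of_nat (F_fac (2 * B))) = ereal (a_total B S p)"
proof -
  have "a_total B S p = of_int (\<Sum>\<nu> = 1..K. a_exp B S (p ^ \<nu>))"
    unfolding a_total_def by (rule infsum_prime_powers[OF assms]) (rule a_exp_eq_0)
  then show ?thesis
    unfolding sum_a_exp[OF assms] by (simp add: vp_of_nat assms(1) Pi_prod_pos F_fac_pos)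
qed

section \<open>The odd primes up to 250\<close>

definition odd_primes_upto_250 :: "int list" where
  "odd_primes_upto_250 = [3, 5, 7, 11, 13, 17, 19, 23, 29, 31, 37, 41, 43, 47, 53, 59, 61, 67, 71, 73, 79,
     83, 89, 97, 101, 103, 107, 109, 113, 127, 131, 137, 139, 149, 151, 157, 163, 167, 173, 179,
     181, 191, 193, 197, 199, 211, 223, 227, 229, 233, 239, 241]"

text \<open>
  Trial division: \<open>16 * 16 > 250\<close>, so a composite number in this range has a divisor below \<open>16\<close>.
\<close>
lemma odd_primes_upto_250_no_small_divisor:
  "\<forall>n\<in>set odd_primes_upto_250. 2 < n \<and> n \<le> 250 \<and> (\<forall>d\<in>set [2..15]. d < n \<longrightarrow> \<not> d dvd n)"
  by code_simp

lemma odd_primes_upto_250_complete: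
  "\<forall>n\<in>set [3..250]. n \<in> set odd_primes_upto_250 \<or> (\<exists>d\<in>set [2, 3, 5, 7, 11, 13]. d < n \<and> d dvd n)"
  by code_simp

lemma odd_primes_upto_250_prime:
  assumes "n \<in> set odd_primes_upto_250"
  shows "prime n" "odd n" "2 < n" "n \<le> 250"
proof -
  have n: "2 < n" "n \<le> 250" and no: "\<And>d. 2 \<le> d \<Longrightarrow> d \<le> 15 \<Longrightarrow> d < n \<Longrightarrow> \<not> d dvd n"
    using odd_primes_upto_250_no_small_divisor assms unfolding set_upto by auto
  show "2 < n" "n \<le> 250" by (fact n)+
  show "odd n" using no[of 2] n by simp
  show "prime n"
    unfolding prime_int_iff
  proof (intro conjI allI impI)
    fix d assume "0 \<le> d \<and> d dvd n"
    then obtain e where d: "n = d * e" "0 \<le> d" by (auto elim: dvdE)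
    have "0 < d * e" using d n by linarith
    then have pos: "d > 0" "e > 0" using d(2) by (auto simp: zero_less_mult_iff)
    show "d = 1 \<or> d = n"
    proof (rule ccontr)
      assume "\<not> (d = 1 \<or> d = n)"
      then have "d \<noteq> 1" "e \<noteq> 1" using d(1) by auto
      then have ge: "d \<ge> 2" "e \<ge> 2" using pos by linarith+
      then have "d * 1 < d * e" "1 * e < d * e" using pos by (simp_all add: mult_strict_left_mono)
      then have "d < n" "e < n" using d(1) by simp_all
      then have "d \<ge> 16" "e \<ge> 16" using no[OF ge(1)] no[OF ge(2)] d(1) by force+
      then have "16 * 16 \<le> d * e" by (intro mult_mono) auto
      then show False using d n by simp
    qed
  qed (use n in simp)
qed

lemma int_mem_odd_primes_upto_250_iff:
  "int p \<in> set odd_primes_upto_250 \<longleftrightarrow> prime p \<and> odd p \<and> p \<le> 250"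
proof
  assume p: "int p \<in> set odd_primes_upto_250"
  then show "prime p \<and> odd p \<and> p \<le> 250"
    using odd_primes_upto_250_prime[OF p] by (simp add: even_nat_iff)
next
  assume p: "prime p \<and> odd p \<and> p \<le> 250"
  then have "p \<noteq> 2" "p \<ge> 2" using prime_ge_2_nat by auto
  then have "int p \<in> set [3..250]" using p unfolding set_upto by simp
  moreover have "\<not> (d < int p \<and> d dvd int p)" if "d \<in> set [2, 3, 5, 7, 11, 13]" for d
  proof -
    have "d > 1" using that by auto
    then have "d \<ge> 0" by simp
    moreover have "prime (int p)" using p by simp
    ultimately have "d dvd int p \<Longrightarrow> d = 1 \<or> d = int p" unfolding prime_int_iff by simp
    then show ?thesis using \<open>d > 1\<close> by auto
  qed
  ultimately show "int p \<in> set odd_primes_upto_250" using odd_primes_upto_250_complete by blast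
qed

section \<open>Termwise bounds for the matrix entries\<close>

text \<open>
  Each term of the sum has a denominator whose multiplicity is at most \<open>2 * L\<close>; nothing is
  gained or lost by the signs.
\<close>
lemma padic_ge_catalan_sum:
  assumes "prime p" "\<And>k. k < m \<Longrightarrow> multiplicity p (2 * k + 1) \<le> L"
  shows "padic_ge p (- (2 * int L)) (catalan_sum m)"
  unfolding catalan_sum_def
proof (rule padic_ge_sum)
  fix k assume "k \<in> {..<m}"
  then have v: "multiplicity p ((2 * k + 1) ^ 2) \<le> 2 * L"
    using assms by (subst prime_elem_multiplicity_power_distrib) auto
  have "padic_ge p (0 + - int (2 * L)) (of_int ((- 1) ^ k) * (1 / of_nat ((2 * k + 1) ^ 2)))"
    using assms(1) v by (intro padic_ge_mult padic_ge_of_int padic_ge_inverse) auto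
  then show "padic_ge p (- (2 * int L)) ((- 1) ^ k / (2 * of_nat k + 1) ^ 2)"
    by (simp add: add.commute)
qed (rule assms(1))

lemma poly_u_poly_scaled:
  fixes q :: int
  assumes "q \<noteq> 0"
  shows "of_int q * poly (u_poly m) (of_int a / of_int q) =
    of_int ((- 1) ^ m) * (of_int a - of_int q * catalan_sum m) * (1 / of_nat (2 * m + 1))"
proof -
  define s where "s = (- 1 :: rat) ^ m / of_nat (2 * m + 1)"
  have "of_int q * (of_int a / of_int q :: rat) = of_int a" using assms by simp
  then have "of_int q * (s * (of_int a / of_int q - catalan_sum m)) = s * (of_int a - of_int q * catalan_sum m)"
    by (simp only: right_diff_distrib mult.left_commute)
  moreover have "poly (u_poly m) t = s * (t - catalan_sum m)" for t
    by (simp add: u_poly_def s_def algebra_simps diff_divide_distrib)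
  ultimately have "of_int q * poly (u_poly m) (of_int a / of_int q) = s * (of_int a - of_int q * catalan_sum m)"
    by (simp only:)
  then show ?thesis by (simp add: s_def mult.commute)
qed

lemma padic_ge_u_poly:
  fixes a q :: int
  assumes "prime p" "q \<noteq> 0" "\<And>k. k < m \<Longrightarrow> multiplicity p (2 * k + 1) \<le> L"
  shows "padic_ge p (- int (2 * L + multiplicity p (2 * m + 1)))
    (of_int q * poly (u_poly m) (of_int a / of_int q))"
proof -
  have "padic_ge p (0 + - (2 * int L)) (of_int q * catalan_sum m)"
    using assms by (intro padic_ge_mult padic_ge_of_int padic_ge_catalan_sum) auto
  moreover have "padic_ge p (0 + - (2 * int L)) (of_int a)"
    using assms(1) by (intro padic_ge_mono[OF padic_ge_of_int]) auto
  ultimately have "padic_ge p (0 + - (2 * int L)) (of_int a - of_int q * catalan_sum m)"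
    using assms(1) by (intro padic_ge_diff)
  then have "padic_ge p (0 + (0 + - (2 * int L)) + - int (multiplicity p (2 * m + 1)))
    (of_int ((- 1) ^ m) * (of_int a - of_int q * catalan_sum m) * (1 / of_nat (2 * m + 1)))"
    using assms(1) by (intro padic_ge_mult padic_ge_of_int padic_ge_inverse) auto
  then show ?thesis unfolding poly_u_poly_scaled[OF assms(2)] by (simp add: algebra_simps)
qed

text \<open>
  The contribution of one level \<open>Q = p ^ \<nu>\<close> to the valuation of \<open>q \<Pi>\<^sub>i u\<^sub>i\<^sub>+\<^sub>j(a/q)\<close>: the factors of
  \<open>\<Pi>\<^sub>i\<close>, the denominator \<open>2(i+j)+1\<close>, and the squares in the denominator of the partial sum, which
  involves odd numbers up to \<open>2(i+j)-1\<close>. For odd \<open>Q\<close> the condition \<open>Q < 2 * (i + j)\<close> says exactly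
  that \<open>Q \<le> 2(i+j)-1\<close>, without a subtraction.
\<close>
definition col_exp :: "nat \<Rightarrow> nat \<Rightarrow> nat \<Rightarrow> nat \<Rightarrow> int" where
  "col_exp B j Q i = 2 * int (Ncount B Q i) - (if Q dvd 2 * (i + j) + 1 then 1 else 0)
     - 2 * (if Q < 2 * (i + j) then 1 else 0)"

lemma padic_ge_Pi_fac_u_poly:
  fixes a q :: int
  assumes "prime p" "q \<noteq> 0" "2 * (i + j) + 1 < p ^ Suc K" "2 * (B + i) + 1 < p ^ Suc K"
  shows "padic_ge p (\<Sum>\<nu> = 1..K. col_exp B j (p ^ \<nu>) i)
    (of_nat (Pi_fac B i) * (of_int q * poly (u_poly (i + j)) (of_int a / of_int q)))"
proof -
  define L where "L = (\<Sum>\<nu> = 1..K. if p ^ \<nu> < 2 * (i + j) then 1 else 0 :: nat)"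
  have "multiplicity p (2 * k + 1) \<le> L" if "k < i + j" for k
  proof -
    have "multiplicity p (2 * k + 1) = (\<Sum>\<nu> = 1..K. if p ^ \<nu> dvd 2 * k + 1 then 1 else 0)"
      using that assms by (intro multiplicity_eq_sum_dvd) auto
    also have "\<dots> \<le> L"
      unfolding L_def
    proof (rule sum_mono)
      fix \<nu>
      show "(if p ^ \<nu> dvd 2 * k + 1 then 1 else 0) \<le> (if p ^ \<nu> < 2 * (i + j) then 1 else 0 :: nat)"
        using dvd_imp_le[of "p ^ \<nu>" "2 * k + 1"] that by auto
    qed
    finally show ?thesis .
  qed
  then have "padic_ge p (int (multiplicity p (Pi_fac B i)) + - int (2 * L + multiplicity p (2 * (i + j) + 1)))
    (of_nat (Pi_fac B i) * (of_int q * poly (u_poly (i + j)) (of_int a / of_int q)))"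
    using assms by (intro padic_ge_mult padic_ge_of_nat padic_ge_u_poly) auto
  moreover have "int (multiplicity p (Pi_fac B i)) + - int (2 * L + multiplicity p (2 * (i + j) + 1))
      = (\<Sum>\<nu> = 1..K. col_exp B j (p ^ \<nu>) i)"
  proof -
    have "multiplicity p (2 * (i + j) + 1) = (\<Sum>\<nu> = 1..K. if p ^ \<nu> dvd 2 * (i + j) + 1 then 1 else 0)"
      using assms by (intro multiplicity_eq_sum_dvd) auto
    moreover have "multiplicity p (Pi_fac B i) = 2 * (\<Sum>\<nu> = 1..K. Ncount B (p ^ \<nu>) i)"
      using assms by (intro multiplicity_Pi_fac) auto
    ultimately show ?thesis
      unfolding L_def col_exp_def
      by (simp add: sum_subtractf sum_distrib_left sum.distrib if_distrib[of int] cong: if_cong)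
  qed
  ultimately show ?thesis by simp
qed

text \<open>
  The shape of a matrix entry with arbitrary integer weights in place of the signed binomial
  coefficients, so that linear combinations of rows are covered by the same estimate.
\<close>
definition row_comb :: "nat \<Rightarrow> nat \<Rightarrow> (nat \<Rightarrow> int) \<Rightarrow> nat \<Rightarrow> rat \<Rightarrow> rat" where
  "row_comb B n w j t = (\<Sum>i\<le>n. of_int (w i) * of_nat (Pi_fac B i) * poly (u_poly (i + j)) t)"

lemma poly_R_entry:
  "poly (R_entry B a j) t = row_comb B (a + 2 * B) (\<lambda>i. (- 1) ^ i * int ((a + 2 * B) choose i)) j t"
  by (simp add: R_entry_def row_comb_def poly_sum atLeast0AtMost)

lemma padic_ge_row_comb:
  fixes a q :: int
  assumes "prime p" "q \<noteq> 0" "2 * (n + j) + 1 < p ^ Suc K" "2 * (B + n) + 1 < p ^ Suc K"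
    and "\<And>i. i \<le> n \<Longrightarrow> padic_ge p (k - (\<Sum>\<nu> = 1..K. col_exp B j (p ^ \<nu>) i)) (of_int (w i))"
  shows "padic_ge p k (of_int q * row_comb B n w j (of_int a / of_int q))"
proof -
  have "of_int q * row_comb B n w j (of_int a / of_int q) = (\<Sum>i\<le>n. of_int (w i) *
      (of_nat (Pi_fac B i) * (of_int q * poly (u_poly (i + j)) (of_int a / of_int q))))"
    unfolding row_comb_def sum_distrib_left by (intro sum.cong refl) (simp only: mult_ac)
  moreover have "padic_ge p k \<dots>"
  proof (intro padic_ge_sum assms(1))
    fix i assume "i \<in> {..n}"
    then have "padic_ge p (k - (\<Sum>\<nu> = 1..K. col_exp B j (p ^ \<nu>) i) + (\<Sum>\<nu> = 1..K. col_exp B j (p ^ \<nu>) i))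
     (of_int (w i) * (of_nat (Pi_fac B i) * (of_int q * poly (u_poly (i + j)) (of_int a / of_int q))))"
      using assms by (intro padic_ge_mult padic_ge_Pi_fac_u_poly) auto
    then show "padic_ge p k (of_int (w i) *
      (of_nat (Pi_fac B i) * (of_int q * poly (u_poly (i + j)) (of_int a / of_int q))))"
      by simp
  qed
  ultimately show ?thesis by simp
qed

definition binom_exp :: "nat \<Rightarrow> nat \<Rightarrow> nat \<Rightarrow> int" where
  "binom_exp n Q i = int (n div Q) - int (i div Q) - int ((n - i) div Q)"

lemma padic_ge_binomial:
  assumes "prime p" "n < p ^ Suc K" "i \<le> n"
  shows "padic_ge p (\<Sum>\<nu> = 1..K. binom_exp n (p ^ \<nu>) i) (of_int ((- 1) ^ i * int (n choose i)))"
proof -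
  have "padic_ge p (0 + int (multiplicity p (n choose i))) (of_int ((- 1) ^ i) * of_nat (n choose i))"
    using assms(1) by (intro padic_ge_mult padic_ge_of_int padic_ge_of_nat) auto
  then show ?thesis
    by (simp add: multiplicity_binomial[OF assms] binom_exp_def)
qed

definition term_exp :: "nat \<Rightarrow> nat \<Rightarrow> nat \<Rightarrow> nat \<Rightarrow> nat \<Rightarrow> int" where
  "term_exp B a j Q i = binom_exp (a + 2 * B) Q i + col_exp B j Q i"

lemma padic_ge_R_entry:
  fixes c q :: int
  assumes "prime p" "q \<noteq> 0" "2 * (a + 2 * B + j + B) + 1 < p ^ Suc K"
    and "\<And>i. i \<le> a + 2 * B \<Longrightarrow> k \<le> (\<Sum>\<nu> = 1..K. term_exp B a j (p ^ \<nu>) i)"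
  shows "padic_ge p k (of_int q * poly (R_entry B a j) (of_int c / of_int q))"
  unfolding poly_R_entry
proof (rule padic_ge_row_comb[where K = K])
  fix i assume i: "i \<le> a + 2 * B"
  then have "padic_ge p (\<Sum>\<nu> = 1..K. binom_exp (a + 2 * B) (p ^ \<nu>) i)
      (of_int ((- 1) ^ i * int ((a + 2 * B) choose i)))"
    using assms(1,3) by (intro padic_ge_binomial) auto
  then show "padic_ge p (k - (\<Sum>\<nu> = 1..K. col_exp B j (p ^ \<nu>) i))
      (of_int ((- 1) ^ i * int ((a + 2 * B) choose i)))"
    using assms(4)[OF i] by (elim padic_ge_mono) (auto simp: term_exp_def sum.distrib assms(1))
qed (use assms in auto)

text \<open>
  All denominators that occur are odd.
\<close>
lemma two_adic_R_entry:
  fixes c q :: int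
  assumes "q \<noteq> 0"
  shows "padic_ge 2 0 (of_int q * poly (R_entry B a j) (of_int c / of_int q))"
proof -
  have "padic_ge 2 0 (of_int q * poly (u_poly m) (of_int c / of_int q))" for m
  proof -
    have "multiplicity 2 (2 * k + 1) = 0" for k :: nat
      by (rule not_dvd_imp_multiplicity_0) simp
    then show ?thesis
      using padic_ge_u_poly[of 2 q m 0 c] assms by simp
  qed
  then have "padic_ge 2 (0 + 0) (of_int (((- 1) ^ i * int ((a + 2 * B) choose i)) * int (Pi_fac B i)) *
      (of_int q * poly (u_poly (i + j)) (of_int c / of_int q)))" for i
    by (intro padic_ge_mult padic_ge_of_int) auto
  then have "padic_ge 2 0 (\<Sum>i\<le>a + 2 * B. of_int (((- 1) ^ i * int ((a + 2 * B) choose i)) * int (Pi_fac B i)) *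
      (of_int q * poly (u_poly (i + j)) (of_int c / of_int q)))"
    by (intro padic_ge_sum) simp_all
  also have "(\<Sum>i\<le>a + 2 * B. of_int (((- 1) ^ i * int ((a + 2 * B) choose i)) * int (Pi_fac B i)) *
      (of_int q * poly (u_poly (i + j)) (of_int c / of_int q)))
      = of_int q * poly (R_entry B a j) (of_int c / of_int q)"
    unfolding poly_R_entry row_comb_def sum_distrib_left
    by (intro sum.cong refl) (simp add: mult_ac)
  finally show ?thesis .
qed

lemma det_R_mat_1: "det (R_mat B 1 {a}) = R_entry B a 1"
  by (subst det_single) (auto simp: R_mat_def)

lemma det_R_mat_2:
  assumes "a < b"
  shows "det (R_mat B 2 {a, b}) = R_entry B a 1 * R_entry B b 2 - R_entry B a 2 * R_entry B b 1"
proof -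
  have s: "sorted_list_of_set {a, b} = [a, b]"
    using assms by (simp add: sorted_list_of_set_insert)
  have "R_mat B 2 {a, b} \<in> carrier_mat 2 2" by (simp add: R_mat_def)
  from laplace_expansion_row[OF this, of 0]
  show ?thesis
    by (simp add: R_mat_def s cofactor_def mat_delete_def det_single lessThan_Suc numeral_2_eq_2)
qed

lemma two_adic_det_R_mat:
  fixes c q :: int
  assumes "q \<noteq> 0"
  shows "padic_ge 2 0 (of_int q ^ 1 * poly (det (R_mat B 1 {a})) (of_int c / of_int q))"
    and "padic_ge 2 0 (of_int q ^ 2 * poly (det (R_mat B 2 {0, 1})) (of_int c / of_int q))"
proof -
  show "padic_ge 2 0 (of_int q ^ 1 * poly (det (R_mat B 1 {a})) (of_int c / of_int q))"
    unfolding det_R_mat_1 using two_adic_R_entry[OF assms] by simp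
  have "det (R_mat B 2 {0, 1}) = R_entry B 0 1 * R_entry B 1 2 - R_entry B 0 2 * R_entry B 1 1"
    by (rule det_R_mat_2) simp
  then show "padic_ge 2 0 (of_int q ^ 2 * poly (det (R_mat B 2 {0, 1})) (of_int c / of_int q))"
    unfolding \<open>det (R_mat B 2 {0, 1}) = _\<close> poly_diff poly_mult
    using assms
    by (intro padic_ge_2x2[OF two_is_prime_nat two_adic_R_entry two_adic_R_entry
        two_adic_R_entry two_adic_R_entry]) auto
qed

section \<open>The minimum over sets of one or two indices\<close>

text \<open>
  The summand of \<open>i\<close> in \<open>\<lambda>\<close>. Apart from the constant \<open>C\<close>, the function \<open>\<lambda>\<close> is the sum of these
  values plus a penalty of \<open>2\<close> for each pair of congruent indices.
\<close>
definition lam_point :: "nat \<Rightarrow> nat \<Rightarrow> nat \<Rightarrow> nat \<Rightarrow> int" where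
  "lam_point B S Q i = 2 * int (Ncount B Q i) - int (Ncount S Q i)
     - 2 * (if Q \<le> 2 * i + 1 then 1 else 0) - int (F_exp (NN B S) Q i)"

lemma lam_singleton: "lam B S A Q {i} = int (C_sum B A Q) + lam_point B S Q i"
proof -
  have "n_res Q r {i} \<le> 1" for r
    unfolding n_res_def using card_mono[of "{i}" "{k \<in> {i}. k mod Q = r}"] by auto
  then have "n_res Q r {i} choose 2 = 0" for r
    by (intro binomial_eq_0) (simp add: numeral_2_eq_2 less_Suc_eq_le)
  then show ?thesis by (simp add: lam_def lam_point_def del: binomial_eq_0_iff)
qed

lemma lam_pair:
  assumes "i \<noteq> j" "Q > 0"
  shows "lam B S A Q {i, j} = int (C_sum B A Q) + lam_point B S Q i + lam_point B S Q j
    + (if j mod Q = i mod Q then 2 else 0)"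
proof -
  have "n_res Q r {i, j} choose 2 = (if r = i mod Q then if j mod Q = i mod Q then 1 else 0 else 0)" for r
  proof -
    have "{k \<in> {i, j}. k mod Q = r} = (if i mod Q = r then {i} else {}) \<union> (if j mod Q = r then {j} else {})"
      by auto
    then show ?thesis using assms(1) unfolding n_res_def by (auto simp: binomial_eq_0 numeral_2_eq_2)
  qed
  then have "(\<Sum>r<Q. int (n_res Q r {i, j} choose 2)) = (if j mod Q = i mod Q then 1 else 0)"
    using assms(2) by (simp add: if_distrib[of int] sum.delta cong: if_cong)
  then show ?thesis using assms(1) by (simp add: lam_def lam_point_def)
qed

lemma m_exp_singleton:
  "m_exp B 1 A Q = int (C_sum B A Q) + Min (lam_point B 1 Q ` {..<NN B 1})"
proof -
  have "{I. I \<subseteq> {..<NN B 1} \<and> card I = 1} = (\<lambda>i. {i}) ` {..<NN B 1}"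
    by (auto simp: card_1_singleton_iff)
  then have "m_exp B 1 A Q = Min ((\<lambda>i. lam_point B 1 Q i + int (C_sum B A Q)) ` {..<NN B 1})"
    unfolding m_exp_def by (simp add: image_image lam_singleton add.commute)
  also have "\<dots> = Min (lam_point B 1 Q ` {..<NN B 1}) + int (C_sum B A Q)"
    by (rule Min_add_commute) (auto simp: NN_def lessThan_empty_iff)
  finally show ?thesis by simp
qed

text \<open>
  Some optimal pair contains a given minimiser \<open>i\<^sub>0\<close>. If neither index of a pair is \<open>i\<^sub>0\<close>, exchange
  one of them for \<open>i\<^sub>0\<close>, keeping an index not congruent to \<open>i\<^sub>0\<close> if there is one: then the
  penalty does not grow, since it is either absent afterwards, or both indices were congruent to
  \<open>i\<^sub>0\<close>, hence to each other, and the penalty had been paid already.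
\<close>
lemma m_exp_pair:
  assumes "Q > 0" "i\<^sub>0 < NN B 2" "\<And>i. i < NN B 2 \<Longrightarrow> lam_point B 2 Q i\<^sub>0 \<le> lam_point B 2 Q i"
  shows "m_exp B 2 A Q = int (C_sum B A Q) + (lam_point B 2 Q i\<^sub>0 +
    Min ((\<lambda>j. lam_point B 2 Q j + (if j mod Q = i\<^sub>0 mod Q then 2 else 0)) ` ({..<NN B 2} - {i\<^sub>0})))"
    (is "_ = _ + (?f i\<^sub>0 + Min (?g ` ?J))")
proof -
  have "0 \<in> ?J \<or> 1 \<in> ?J" by (auto simp: NN_def)
  then have J: "?g ` ?J \<noteq> {}" "finite (?g ` ?J)" by auto
  show ?thesis
    unfolding m_exp_def
  proof (rule Min_eqI)
    show "finite (lam B 2 A Q ` {I. I \<subseteq> {..<NN B 2} \<and> card I = 2})" by simp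
  next
    fix y assume "y \<in> lam B 2 A Q ` {I. I \<subseteq> {..<NN B 2} \<and> card I = 2}"
    then obtain i j where ij: "i \<noteq> j" "i < NN B 2" "j < NN B 2" "y = lam B 2 A Q {i, j}"
      by (auto simp: card_2_iff)
    have ge: "Min (?g ` ?J) \<le> ?g k" if "k < NN B 2" "k \<noteq> i\<^sub>0" for k
      using that J(2) by (intro Min_le) auto
    have f: "?f i\<^sub>0 \<le> ?f i" "?f i\<^sub>0 \<le> ?f j" using assms(3) ij by auto
    have y: "y = int (C_sum B A Q) + ?f i + ?f j + (if j mod Q = i mod Q then 2 else 0)"
      unfolding ij(4) using ij(1) assms(1) by (rule lam_pair)
    consider "i = i\<^sub>0" | "j = i\<^sub>0" | "i \<noteq> i\<^sub>0" "j \<noteq> i\<^sub>0" by blast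
    then show "int (C_sum B A Q) + (?f i\<^sub>0 + Min (?g ` ?J)) \<le> y"
    proof cases
      case 1
      then show ?thesis using ge[of j] ij(1-3) y by simp
    next
      case 2
      then show ?thesis using ge[of i] ij(1-3) y by (simp add: eq_commute)
    next
      case 3
      show ?thesis
        using ge[of i] ge[of j] 3 ij(2,3) f
        by (cases "i mod Q = i\<^sub>0 mod Q"; cases "j mod Q = i\<^sub>0 mod Q") (auto simp: y)
    qed
  next
    obtain j where j: "j \<in> ?J" "Min (?g ` ?J) = ?g j"
      using Min_in[OF J(2,1)] by (auto simp del: Min_in)
    then have eq: "int (C_sum B A Q) + (?f i\<^sub>0 + Min (?g ` ?J)) = lam B 2 A Q {i\<^sub>0, j}"
      using lam_pair[of i\<^sub>0 j Q B 2 A] assms(1) by simp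
    have mem: "{i\<^sub>0, j} \<in> {I. I \<subseteq> {..<NN B 2} \<and> card I = 2}"
      using j assms(2) by auto
    show "int (C_sum B A Q) + (?f i\<^sub>0 + Min (?g ` ?J))
        \<in> lam B 2 A Q ` {I. I \<subseteq> {..<NN B 2} \<and> card I = 2}"
      unfolding eq using mem by (rule imageI)
  qed
qed

section \<open>The exponents in integer arithmetic\<close>

text \<open>
  For odd \<open>Q\<close>, the number of odd multiples of \<open>Q\<close> in \<open>1, \<dots>, 2i+1\<close>. Differences of this function
  replace the cardinalities in the statement by two divisions.
\<close>
definition oddcount :: "int \<Rightarrow> int \<Rightarrow> int" where
  "oddcount Q i = (2 * i + 1 + Q) div (2 * Q)"

text \<open>
  With \<open>Q = 2r+1\<close> the count is \<open>(i+r+1) div Q\<close>, and \<open>Q\<close> divides \<open>i+r+2\<close> if and only if it divides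
  the double \<open>(2i+3) + Q\<close>.
\<close>
lemma oddcount_Suc:
  assumes "odd Q"
  shows "oddcount (int Q) (int (Suc n)) =
    oddcount (int Q) (int n) + (if Q dvd 2 * Suc n + 1 then 1 else 0)"
proof -
  obtain r where r: "Q = 2 * r + 1" using assms by (elim oddE)
  have count: "oddcount (int Q) (int m) = int ((m + r + 1) div Q)" for m
  proof -
    have "oddcount (int Q) (int m) = (2 * int (m + r + 1)) div (2 * int Q)"
      by (simp add: oddcount_def r algebra_simps)
    then show ?thesis by (simp only: div_mult_mult1_if zdiv_int) simp
  qed
  have "coprime Q 2" using assms by simp
  then have "Q dvd n + r + 2 \<longleftrightarrow> Q dvd 2 * (n + r + 2)"
    by (simp only: coprime_dvd_mult_right_iff)
  also have "2 * (n + r + 2) = (2 * Suc n + 1) + Q" by (simp add: r)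
  finally have "Q dvd n + r + 2 \<longleftrightarrow> Q dvd 2 * Suc n + 1" by (simp only: dvd_add_triv_right_iff)
  moreover have "(Suc n + r + 1) div Q = (n + r + 1) div Q + (if Q dvd n + r + 2 then 1 else 0)"
    using div_Suc[of "n + r + 1" Q] by (simp add: dvd_eq_mod_eq_0)
  ultimately show ?thesis unfolding count by simp
qed

lemma Ncount_Suc: "Ncount (Suc K) Q i = Ncount K Q i + (if Q dvd 2 * Suc (i + K) + 1 then 1 else 0)"
proof -
  have "{h \<in> {1..Suc K}. Q dvd 2 * i + 2 * h + 1} =
      {h \<in> {1..K}. Q dvd 2 * i + 2 * h + 1} \<union> (if Q dvd 2 * i + 2 * Suc K + 1 then {Suc K} else {})"
    by (auto simp: le_Suc_eq)
  then have "Ncount (Suc K) Q i = Ncount K Q i + (if Q dvd 2 * i + 2 * Suc K + 1 then 1 else 0)"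
    unfolding Ncount_def by (simp add: card_Un_disjoint)
  moreover have "2 * i + 2 * Suc K + 1 = 2 * Suc (i + K) + 1" by simp
  ultimately show ?thesis by (simp only:)
qed

lemma int_Ncount:
  assumes "odd Q"
  shows "int (Ncount K Q i) = oddcount (int Q) (int i + int K) - oddcount (int Q) (int i)"
proof (induction K)
  case 0
  then show ?case by (simp add: Ncount_def)
next
  case (Suc K)
  have "int i + int (Suc K) = int (Suc (i + K))" by simp
  then have "oddcount (int Q) (int i + int (Suc K)) = oddcount (int Q) (int (Suc (i + K)))"
    by (simp only:)
  also have "\<dots> = oddcount (int Q) (int i + int K) + (if Q dvd 2 * Suc (i + K) + 1 then 1 else 0)"
    unfolding oddcount_Suc[OF assms] by simp
  finally show ?case unfolding Ncount_Suc using Suc by simp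
qed

text \<open>
  The functions with suffix \<open>code\<close> restate the exponents over the integers with
  lists in place of sets, a form suited to evaluation by rewriting on binary numerals.
\<close>
definition lam_point_code :: "int \<Rightarrow> int \<Rightarrow> int \<Rightarrow> int \<Rightarrow> int" where
  "lam_point_code B S Q i = 2 * (oddcount Q (i + B) - oddcount Q i) - (oddcount Q (i + S) - oddcount Q i)
     - (if Q \<le> 2 * i + 1 then 2 else 0) - (i div Q + (2 * B + S + 2 - i) div Q)"

lemma lam_point_eq_code:
  assumes "odd Q" "i < NN B S"
  shows "lam_point B S Q i = lam_point_code (int B) (int S) (int Q) (int i)"
proof -
  have "int (NN B S - 1 - i) = 2 * int B + int S + 2 - int i"
    using assms(2) by (simp add: NN_def)
  then have "int (F_exp (NN B S) Q i) = int i div int Q + (2 * int B + int S + 2 - int i) div int Q"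
    by (simp add: F_exp_def zdiv_int)
  moreover have "Q \<le> 2 * i + 1 \<longleftrightarrow> int Q \<le> 2 * int i + 1" by linarith
  ultimately show ?thesis
    by (simp add: lam_point_def lam_point_code_def int_Ncount[OF assms(1)])
qed

definition a_code :: "int \<Rightarrow> int \<Rightarrow> int \<Rightarrow> int" where
  "a_code B S Q = 2 * sum_list (map (\<lambda>i. oddcount Q (i + B) - oddcount Q i) [0..2 * B + S + 2])
     - sum_list (map (\<lambda>r. r div Q) [0..2 * B - 1])"

lemma set_upto_int: "set [0..int n - 1] = int ` {..<n}"
  by (auto simp: image_iff intro!: bexI[of _ "nat _"])

lemma sum_list_upto_int: "sum_list (map f [0..int n - 1]) = (\<Sum>i<n. f (int i))"
proof -
  have "sum_list (map f [0..int n - 1]) = sum f {0..int n - 1}"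
    by (simp add: sum_list_distinct_conv_sum_set)
  also have "{0..int n - 1} = int ` {..<n}"
    using set_upto_int by simp
  finally show ?thesis by (simp add: sum.reindex)
qed

lemma a_exp_eq_code:
  assumes "odd Q"
  shows "a_exp B S Q = a_code (int B) (int S) (int Q)"
proof -
  have "2 * int B + int S + 2 = int (NN B S) - 1" "2 * int B - 1 = int (2 * B) - 1"
    by (simp_all add: NN_def)
  then have "a_code (int B) (int S) (int Q) =
      2 * (\<Sum>i<NN B S. oddcount (int Q) (int i + int B) - oddcount (int Q) (int i))
      - (\<Sum>r<2 * B. int r div int Q)"
    unfolding a_code_def by (simp only: sum_list_upto_int)
  then show ?thesis
    by (simp add: a_exp_def int_Ncount[OF assms] Phi_def zdiv_int)
qed

text \<open>
  For \<open>S = 2\<close> the list \<open>fs\<close> pairs each value with its index; the last line implements the greedy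
  choice from \<open>m_exp_pair\<close>.
\<close>
definition m_code :: "int \<Rightarrow> int \<Rightarrow> int list \<Rightarrow> int \<Rightarrow> int" where
  "m_code B S as Q = sum_list (map (\<lambda>a. (a + 2 * B) div Q) as) +
     (let fs = map (\<lambda>i. (lam_point_code B S Q i, i)) [0..2 * B + S + 2] in
      if S = 1 then Min (set (map fst fs))
      else case arg_min_list fst fs of (u, i\<^sub>0) \<Rightarrow>
        u + Min (set (map (\<lambda>(w, j). if j mod Q = i\<^sub>0 mod Q then w + 2 else w) (filter (\<lambda>(w, j). j \<noteq> i\<^sub>0) fs))))"

lemma m_exp_eq_code:
  assumes "odd Q" "S = 1 \<or> S = 2" "distinct as"
  shows "m_exp B S (set as) Q = m_code (int B) (int S) (map int as) (int Q)"
proof -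
  define N where "N = NN B S"
  define f where "f = lam_point B S Q"
  define fs where "fs = map (\<lambda>i. (lam_point_code (int B) (int S) (int Q) i, i)) [0..int N - 1]"
  have N: "2 * int B + int S + 2 = int N - 1" by (simp add: N_def NN_def)
  have Q: "Q > 0" using assms(1) by (rule odd_pos)
  have set_fs: "set fs = (\<lambda>i. (f i, int i)) ` {..<N}"
    using lam_point_eq_code[OF assms(1)]
    by (auto simp: fs_def set_upto_int f_def N_def image_image simp del: set_upto intro!: image_cong)
  have C: "sum_list (map (\<lambda>a. (a + 2 * int B) div int Q) (map int as)) = int (C_sum B (set as) Q)"
    using assms(3) by (simp add: C_sum_def sum_list_distinct_conv_sum_set zdiv_int comp_def)
  have code: "m_code (int B) (int S) (map int as) (int Q) = int (C_sum B (set as) Q) +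
     (if S = 1 then Min (set (map fst fs))
      else case arg_min_list fst fs of (u, i\<^sub>0) \<Rightarrow>
        u + Min (set (map (\<lambda>(w, j). if j mod int Q = i\<^sub>0 mod int Q then w + 2 else w)
                          (filter (\<lambda>(w, j). j \<noteq> i\<^sub>0) fs))))"
    unfolding m_code_def C N Let_def fs_def by simp
  show ?thesis
  proof (cases "S = 1")
    case True
    then show ?thesis
      unfolding code by (simp add: m_exp_singleton[unfolded One_nat_def] set_fs image_image f_def N_def)
  next
    case False
    then have S: "S = 2" using assms(2) by simp
    have "fs \<noteq> []" using set_fs by (auto simp: N_def NN_def lessThan_empty_iff simp flip: set_empty2)
    from arg_min_list_in[OF this, of fst] obtain i\<^sub>0
      where i0: "i\<^sub>0 < N" "arg_min_list fst fs = (f i\<^sub>0, int i\<^sub>0)" by (auto simp: set_fs)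
    from f_arg_min_list_f[OF \<open>fs \<noteq> []\<close>, of fst]
    have "f i\<^sub>0 = Min (f ` {..<N})" by (simp add: i0 set_fs image_image)
    then have "f i\<^sub>0 \<le> f i" if "i < N" for i using that by simp
    moreover have "set (map (\<lambda>(w, j). if j mod int Q = int i\<^sub>0 mod int Q then w + 2 else w)
                          (filter (\<lambda>(w, j). j \<noteq> int i\<^sub>0) fs)) =
        (\<lambda>j. f j + (if j mod Q = i\<^sub>0 mod Q then 2 else 0)) ` ({..<N} - {i\<^sub>0})"
    proof -
      have "set (filter (\<lambda>(w, j). j \<noteq> int i\<^sub>0) fs) = (\<lambda>i. (f i, int i)) ` ({..<N} - {i\<^sub>0})"
        by (auto simp: set_fs)
      then show ?thesis
        by (auto simp: image_image simp flip: of_nat_mod intro!: image_cong)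
    qed
    ultimately show ?thesis
      using m_exp_pair[of Q i\<^sub>0 B "set as"] Q i0 S unfolding code i0(2)
      by (simp add: f_def N_def)
  qed
qed

text \<open>
  The coefficient of \<open>log p\<close> in the bound of part (iii). Levels above \<open>250\<close> are cut off since both
  exponents vanish there.
\<close>
definition gap_code :: "int \<Rightarrow> int \<Rightarrow> int list \<Rightarrow> int \<Rightarrow> int" where
  "gap_code B S as p = sum_list (map (\<lambda>Q. if Q > 250 then 0 else a_code B S Q - m_code B S as Q)
     [p, p ^ 2, p ^ 3, p ^ 4, p ^ 5])"

text \<open>
  The reason why five levels suffice: \<open>3 ^ 6 = 729\<close>.
\<close>
lemma less_power_6:
  fixes p :: nat
  assumes "prime p" "odd p" "n \<le> 250"
  shows "n < p ^ Suc 5"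
proof -
  have "p \<noteq> 2" using assms(2) by auto
  then have "p \<ge> 3" using prime_ge_2_nat[OF assms(1)] by linarith
  then have "(3 :: nat) ^ Suc 5 \<le> p ^ Suc 5" by (rule power_mono) simp
  moreover have "(3 :: nat) ^ Suc 5 = 729" by simp
  ultimately show ?thesis using assms(3) by linarith
qed

lemma sum_1_5: "(\<Sum>\<nu> = 1..5. f \<nu>) = f 1 + (f 2 + (f 3 + (f 4 + (f (5 :: nat) :: 'a :: comm_monoid_add))))"
proof -
  have "{1..5 :: nat} = {1, 2, 3, 4, 5}" by auto
  then show ?thesis by simp
qed

lemma gap_code_eq:
  assumes "odd p" "S = 1 \<or> S = 2" "distinct as" "set as \<subseteq> {0..S + 2}" "S \<le> B" "2 * (NN B S + B) \<le> 250"
  shows "gap_code (int B) (int S) (map int as) (int p) =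
    (\<Sum>\<nu> = 1..5. a_exp B S (p ^ \<nu>) - m_exp B S (set as) (p ^ \<nu>))"
proof -
  define F where "F Q = (if Q > 250 then 0
      else a_code (int B) (int S) Q - m_code (int B) (int S) (map int as) Q)" for Q
  have F: "F (int Q) = a_exp B S Q - m_exp B S (set as) Q" if "odd Q" for Q
  proof (cases "Q > 250")
    case True
    then show ?thesis using assms a_exp_eq_0[of B S Q] m_exp_eq_0[of B S Q "set as"] by (simp add: F_def)
  next
    case False
    then show ?thesis using that assms by (simp add: F_def a_exp_eq_code m_exp_eq_code)
  qed
  have "F (int p ^ \<nu>) = a_exp B S (p ^ \<nu>) - m_exp B S (set as) (p ^ \<nu>)" for \<nu>
    using F[of "p ^ \<nu>"] assms(1) by simp
  from this this[of 1] show ?thesis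
    unfolding gap_code_def F_def[symmetric] sum_1_5 by simp
qed

definition col_code :: "int \<Rightarrow> int \<Rightarrow> int \<Rightarrow> int \<Rightarrow> int" where
  "col_code B j Q i = 2 * (oddcount Q (i + B) - oddcount Q i)
     - (if (2 * (i + j) + 1) mod Q = 0 then 1 else 0) - (if Q < 2 * (i + j) then 2 else 0)"

lemma col_exp_eq_code:
  assumes "odd Q"
  shows "col_exp B j Q i = col_code (int B) (int j) (int Q) (int i)"
proof -
  have "Q dvd 2 * (i + j) + 1 \<longleftrightarrow> (2 * (int i + int j) + 1) mod int Q = 0"
    unfolding dvd_eq_mod_eq_0[symmetric] by (subst of_nat_dvd_iff[symmetric, where 'a = int]) (simp add: add.commute)
  moreover have "Q < 2 * (i + j) \<longleftrightarrow> int Q < 2 * (int i + int j)"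
    unfolding of_nat_less_iff[symmetric, where 'a = int] by simp
  ultimately show ?thesis
    by (simp add: col_exp_def col_code_def int_Ncount[OF assms])
qed

definition term_code :: "int \<Rightarrow> int \<Rightarrow> int \<Rightarrow> int \<Rightarrow> int \<Rightarrow> int" where
  "term_code B a j Q i = (a + 2 * B) div Q - i div Q - (a + 2 * B - i) div Q + col_code B j Q i"

lemma term_exp_eq_code:
  assumes "odd Q" "i \<le> a + 2 * B"
  shows "term_exp B a j Q i = term_code (int B) (int a) (int j) (int Q) (int i)"
proof -
  have "int (a + 2 * B - i) = int a + 2 * int B - int i" using assms(2) by simp
  then show ?thesis
    by (simp add: term_exp_def binom_exp_def term_code_def col_exp_eq_code[OF assms(1)] zdiv_int)
qed

definition row_code :: "int \<Rightarrow> int \<Rightarrow> int \<Rightarrow> int \<Rightarrow> int" where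
  "row_code B a j Q = Min (set (map (term_code B a j Q) [0..a + 2 * B]))"

lemma row_code_le:
  assumes "odd Q" "i \<le> a + 2 * B"
  shows "row_code (int B) (int a) (int j) (int Q) \<le> term_exp B a j Q i"
  unfolding row_code_def term_exp_eq_code[OF assms] using assms(2) by (intro Min_le) auto

section \<open>The determinant with one row\<close>

text \<open>
  With a single column, \<open>\<lambda>({i})\<close> differs from \<open>term_exp\<close> only in the binomial coefficient: it
  subtracts \<open>(N-1-i) div Q\<close> instead of the smaller number \<open>(a+2B-i) div Q\<close>. This monotonicity
  is the source of part (ii) for \<open>S = 1\<close>.
\<close>
lemma m_exp_le_term_exp:
  assumes "a \<le> 3" "i \<le> a + 2 * B"
  shows "m_exp B 1 {a} Q \<le> term_exp B a 1 Q i"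
proof -
  have "i < NN B 1" using assms by (simp add: NN_def)
  then have "m_exp B 1 {a} Q \<le> int (C_sum B {a} Q) + lam_point B 1 Q i"
    unfolding m_exp_singleton by (intro add_left_mono Min_le) auto
  also have "\<dots> \<le> term_exp B a 1 Q i"
  proof -
    have "(a + 2 * B - i) div Q \<le> (NN B 1 - 1 - i) div Q"
      using assms by (intro div_le_mono) (simp add: NN_def)
    moreover have "Ncount 1 Q i = (if Q dvd 2 * (i + 1) + 1 then 1 else 0)"
      using Ncount_Suc[of 0 Q i] by (simp add: Ncount_def)
    ultimately show ?thesis
      by (simp add: term_exp_def binom_exp_def col_exp_def lam_point_def C_sum_def F_exp_def)
  qed
  finally show ?thesis .
qed

text \<open>
  The extra unit at \<open>p\<^sub>0\<close> is possible because \<open>m\<close> is a minimum over all \<open>i < N\<close>, while the sum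
  defining the entry stops at \<open>i = a + 2B\<close>, so that fewer primes enter the denominators of
  its partial sums.
\<close>
lemma padic_ge_det_single:
  fixes c q :: int
  assumes "a \<le> 2" "2 * (NN B 1 + B) \<le> 250" "q \<noteq> 0" "prime p" "odd p"
    and "odd p\<^sub>0" "m_code (int B) 1 [int a] (int p\<^sub>0) < row_code (int B) (int a) 1 (int p\<^sub>0)"
  shows "padic_ge p ((\<Sum>\<nu> = 1..5. m_exp B 1 {a} (p ^ \<nu>)) + (if p = p\<^sub>0 then 1 else 0))
    (of_int q ^ 1 * poly (det (R_mat B 1 {a})) (of_int c / of_int q))"
proof -
  have "2 * (a + 2 * B + 1 + B) + 1 < p ^ Suc 5"
    using assms(1,2) by (intro less_power_6 assms(4,5)) (simp add: NN_def)
  moreover have le: "m_exp B 1 {a} Q \<le> term_exp B a 1 Q i" if "i \<le> a + 2 * B" for Q i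
    using assms(1) that by (intro m_exp_le_term_exp) auto
  moreover have "(\<Sum>\<nu> = 1..5. m_exp B 1 {a} (p ^ \<nu>)) + (if p = p\<^sub>0 then 1 else 0)
      \<le> (\<Sum>\<nu> = 1..5. term_exp B a 1 (p ^ \<nu>) i)" if i: "i \<le> a + 2 * B" for i
  proof (cases "p = p\<^sub>0")
    case True
    have "m_exp B 1 {a} p + 1 \<le> term_exp B a 1 p i"
      using assms(7) m_exp_eq_code[OF assms(6), of 1 "[a]" B] row_code_le[OF assms(6) i, of 1] True
      by simp
    then show ?thesis
      using True le[OF i, of "p ^ 2"] le[OF i, of "p ^ 3"] le[OF i, of "p ^ 4"] le[OF i, of "p ^ 5"]
      unfolding sum_1_5 by simp
  next
    case False
    then show ?thesis using le[OF i] by (simp add: sum_mono)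
  qed
  ultimately show ?thesis
    unfolding det_R_mat_1 using assms(3,4) by (simp add: padic_ge_R_entry[where K = 5])
qed

section \<open>The determinant with two rows\<close>

text \<open>
  Beyond the range of the odd numbers involved, only the nonnegative contribution of the binomial
  coefficient is left.
\<close>
lemma term_exp_nonneg:
  assumes "2 * (i + j) + 1 < Q" "2 * (B + i) + 1 < Q" "a + 2 * B < Q"
  shows "0 \<le> term_exp B a j Q i"
  using assms dvd_imp_le[of Q "2 * (i + j) + 1"]
  by (auto simp: term_exp_def binom_exp_def col_exp_def)

text \<open>
  Above \<open>250\<close> the bound from \<open>term_exp_nonneg\<close> takes the place of the minimum over the row, so that
  the tables can stop there.
\<close>
definition level_bound :: "nat \<Rightarrow> nat \<Rightarrow> nat \<Rightarrow> nat \<Rightarrow> int" where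
  "level_bound B a j Q = (if Q > 250 then 0 else row_code (int B) (int a) (int j) (int Q))"

lemma padic_ge_R_entry_levels:
  fixes c q :: int
  assumes "prime p" "odd p" "q \<noteq> 0" "a \<le> 1" "j \<le> 2" "B \<le> 40"
  shows "padic_ge p (\<Sum>\<nu> = 1..5. level_bound B a j (p ^ \<nu>))
    (of_int q * poly (R_entry B a j) (of_int c / of_int q))"
proof (rule padic_ge_R_entry[where K = 5])
  show "2 * (a + 2 * B + j + B) + 1 < p ^ Suc 5"
    using assms by (intro less_power_6) auto
  fix i assume i: "i \<le> a + 2 * B"
  show "(\<Sum>\<nu> = 1..5. level_bound B a j (p ^ \<nu>)) \<le> (\<Sum>\<nu> = 1..5. term_exp B a j (p ^ \<nu>) i)"
  proof (rule sum_mono)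
    fix \<nu>
    have "odd (p ^ \<nu>)" using assms(2) by simp
    then show "level_bound B a j (p ^ \<nu>) \<le> term_exp B a j (p ^ \<nu>) i"
      unfolding level_bound_def using assms i row_code_le[of "p ^ \<nu>" i a B j]
      by (auto intro!: term_exp_nonneg)
  qed
qed (use assms in auto)

text \<open>
  The conditional, rather than a disjunction, prevents the evaluation of the minima
  at the levels above \<open>250\<close>.
\<close>
definition pair_ok :: "int \<Rightarrow> int \<Rightarrow> int \<Rightarrow> bool" where
  "pair_ok B p\<^sub>0 Q = (if Q > 250 then True else
     let m = m_code B 2 [0, 1] Q + (if Q = p\<^sub>0 then 1 else 0) in
     m \<le> row_code B 0 1 Q + row_code B 1 2 Q \<and> m \<le> row_code B 0 2 Q + row_code B 1 1 Q)"

lemma m_exp_le_level_bounds: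
  assumes "odd Q" "B \<le> 40" "2 \<le> B" "pair_ok (int B) (int p\<^sub>0) (int Q)" "p\<^sub>0 \<le> 250"
  shows "m_exp B 2 {0, 1} Q + (if Q = p\<^sub>0 then 1 else 0) \<le> level_bound B 0 1 Q + level_bound B 1 2 Q"
    and "m_exp B 2 {0, 1} Q + (if Q = p\<^sub>0 then 1 else 0) \<le> level_bound B 0 2 Q + level_bound B 1 1 Q"
proof -
  have "m_exp B 2 {0, 1} Q + (if Q = p\<^sub>0 then 1 else 0) \<le> level_bound B 0 1 Q + level_bound B 1 2 Q
    \<and> m_exp B 2 {0, 1} Q + (if Q = p\<^sub>0 then 1 else 0) \<le> level_bound B 0 2 Q + level_bound B 1 1 Q"
  proof (cases "Q > 250")
    case True
    moreover have "m_exp B 2 {0, 1} Q = 0"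
      using assms True by (intro m_exp_eq_0) (auto simp: NN_def)
    ultimately show ?thesis using assms(5) by (simp add: level_bound_def)
  next
    case False
    have "m_exp B 2 {0, 1} Q = m_code (int B) 2 [0, 1] (int Q)"
      using m_exp_eq_code[OF assms(1), of 2 "[0, 1]" B] by simp
    moreover have "(if int Q = int p\<^sub>0 then 1 else 0) = (if Q = p\<^sub>0 then 1 else 0 :: int)" by simp
    ultimately show ?thesis
      using assms(4) False unfolding pair_ok_def Let_def level_bound_def by simp
  qed
  then show "m_exp B 2 {0, 1} Q + (if Q = p\<^sub>0 then 1 else 0) \<le> level_bound B 0 1 Q + level_bound B 1 2 Q"
    and "m_exp B 2 {0, 1} Q + (if Q = p\<^sub>0 then 1 else 0) \<le> level_bound B 0 2 Q + level_bound B 1 1 Q"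
    by auto
qed

text \<open>
  If \<open>p = p\<^sub>0\<close>, the level \<open>\<nu> = 1\<close> supplies the extra unit; all other levels are compared without loss.
\<close>
lemma padic_ge_det_pair:
  fixes c q :: int
  assumes "prime p" "odd p" "q \<noteq> 0" "2 \<le> B" "B \<le> 40" "p\<^sub>0 \<le> 250"
    and ok: "\<And>\<nu>. \<nu> \<in> {1..5} \<Longrightarrow> pair_ok (int B) (int p\<^sub>0) (int p ^ \<nu>)"
  shows "padic_ge p ((\<Sum>\<nu> = 1..5. m_exp B 2 {0, 1} (p ^ \<nu>)) + (if p = p\<^sub>0 then 1 else 0))
    (of_int q ^ 2 * poly (det (R_mat B 2 {0, 1})) (of_int c / of_int q))"
proof -
  let ?m = "\<lambda>\<nu>. m_exp B 2 {0, 1} (p ^ \<nu>) + (if p ^ \<nu> = p\<^sub>0 then 1 else 0)"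
  have m: "(\<Sum>\<nu> = 1..5. m_exp B 2 {0, 1} (p ^ \<nu>)) + (if p = p\<^sub>0 then 1 else 0) \<le> (\<Sum>\<nu> = 1..5. ?m \<nu>)"
  proof -
    have "(if p = p\<^sub>0 then 1 else 0) \<le> (\<Sum>\<nu> = 1..5. if p ^ \<nu> = p\<^sub>0 then 1 else 0 :: int)"
      unfolding sum_1_5 by simp
    then show ?thesis unfolding sum.distrib by (rule add_left_mono)
  qed
  have odd: "odd (p ^ \<nu>)" for \<nu> using assms(2) by simp
  have ok': "pair_ok (int B) (int p\<^sub>0) (int (p ^ \<nu>))" if "\<nu> \<in> {1..5}" for \<nu>
    using ok[OF that] by simp
  note level = m_exp_le_level_bounds[OF odd assms(5,4) ok' assms(6)]
  have "(\<Sum>\<nu> = 1..5. ?m \<nu>) \<le> (\<Sum>\<nu> = 1..5. level_bound B 0 1 (p ^ \<nu>)) + (\<Sum>\<nu> = 1..5. level_bound B 1 2 (p ^ \<nu>))"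
    and "(\<Sum>\<nu> = 1..5. ?m \<nu>) \<le> (\<Sum>\<nu> = 1..5. level_bound B 0 2 (p ^ \<nu>)) + (\<Sum>\<nu> = 1..5. level_bound B 1 1 (p ^ \<nu>))"
    unfolding sum.distrib[of "\<lambda>\<nu>. level_bound B 0 1 (p ^ \<nu>)", symmetric]
      sum.distrib[of "\<lambda>\<nu>. level_bound B 0 2 (p ^ \<nu>)", symmetric]
    by (rule sum_mono, erule level)+
  then have le: "(\<Sum>\<nu> = 1..5. m_exp B 2 {0, 1} (p ^ \<nu>)) + (if p = p\<^sub>0 then 1 else 0)
      \<le> (\<Sum>\<nu> = 1..5. level_bound B 0 1 (p ^ \<nu>)) + (\<Sum>\<nu> = 1..5. level_bound B 1 2 (p ^ \<nu>))"
    "(\<Sum>\<nu> = 1..5. m_exp B 2 {0, 1} (p ^ \<nu>)) + (if p = p\<^sub>0 then 1 else 0)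
      \<le> (\<Sum>\<nu> = 1..5. level_bound B 0 2 (p ^ \<nu>)) + (\<Sum>\<nu> = 1..5. level_bound B 1 1 (p ^ \<nu>))"
    using m by linarith+
  have det: "det (R_mat B 2 {0, 1}) = R_entry B 0 1 * R_entry B 1 2 - R_entry B 0 2 * R_entry B 1 1"
    by (rule det_R_mat_2) simp
  have entry: "padic_ge p (\<Sum>\<nu> = 1..5. level_bound B a j (p ^ \<nu>))
      (of_int q * poly (R_entry B a j) (of_int c / of_int q))" if "a \<le> 1" "j \<le> 2" for a j
    using assms that by (intro padic_ge_R_entry_levels)
  show ?thesis
    unfolding det poly_diff poly_mult
    by (rule padic_ge_2x2[OF assms(1) entry entry entry entry le]) simp_all
qed

text \<open>
  The shorter row may be summed up to the same index as the longer one, because its last binomial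
  coefficient vanishes.
\<close>
lemma R_entry_combination:
  "poly (R_entry B 1 j) t - 2 * poly (R_entry B 0 j) t =
    row_comb B (1 + 2 * B) (\<lambda>i. (- 1) ^ i * (int ((1 + 2 * B) choose i) - 2 * int ((2 * B) choose i))) j t"
proof -
  have "row_comb B (1 + 2 * B) (\<lambda>i. (- 1) ^ i * int ((2 * B) choose i)) j t
      = row_comb B (2 * B) (\<lambda>i. (- 1) ^ i * int ((2 * B) choose i)) j t"
    by (simp add: row_comb_def)
  then have 0: "poly (R_entry B 0 j) t = row_comb B (1 + 2 * B) (\<lambda>i. (- 1) ^ i * int ((2 * B) choose i)) j t"
    by (simp add: poly_R_entry)
  show ?thesis
    unfolding 0 unfolding poly_R_entry unfolding row_comb_def sum_distrib_left sum_subtractf[symmetric]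
    by (intro sum.cong refl) (simp add: algebra_simps)
qed

text \<open>
  For \<open>B = 40\<close> the product \<open>\<Pi>\<^sub>i\<close> runs over \<open>40\<close> consecutive odd numbers starting at \<open>2i+3\<close>. They
  include a multiple of \<open>41\<close> unless \<open>41\<close> divides \<open>2i+1\<close>, that is, \<open>i \<equiv> 20\<close> modulo \<open>41\<close>. These are the indices at which a summand can have
  valuation \<open>-2\<close>.
\<close>
lemma row_bounds_41:
  "\<forall>j\<in>set [1, 2]. \<forall>i\<in>set [0..81].
     if i = 20 \<or> i = 61 then - 2 \<le> col_code 40 j 41 i
     else - 1 \<le> term_code 40 1 j 41 i \<and> (if i = 81 then True else - 1 \<le> term_code 40 0 j 41 i)"
  by code_simp

lemma minima_41:
  "m_code 40 2 [0, 1] 41 \<le> - 3 \<and> - 2 \<le> row_code 40 0 1 41 \<and> - 2 \<le> row_code 40 0 2 41"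
  by code_simp

text \<open>
  From \<open>(81 - i) C(81, i) = 81 C(80, i)\<close> one gets
  \<open>(81 - i) (C(81, i) - 2 C(80, i)) = (2i - 81) C(80, i)\<close>, and \<open>2i - 81\<close> is \<open>-41\<close> or \<open>41\<close>. This is
  why the multiple \<open>2\<close> of the first row is subtracted.
\<close>
lemma dvd_41:
  assumes "i = 20 \<or> i = 61"
  shows "(41 :: int) dvd int ((1 + 2 * 40) choose i) - 2 * int ((2 * 40) choose i)"
proof -
  let ?d = "int (81 choose i) - 2 * int (80 choose i)"
  have "(81 - i) * (81 choose i) = 81 * (80 choose i)"
    using binomial_absorb_comp[of 81 i] by simp
  then have "int (81 - i) * int (81 choose i) = 81 * int (80 choose i)"
    by (simp flip: of_nat_mult)
  then have "int (81 - i) * ?d = 41 * (if i = 20 then - int (80 choose i) else int (80 choose i))"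
    using assms by (auto simp: algebra_simps)
  then have "41 dvd int (81 - i) * ?d" by (rule dvdI)
  moreover have "coprime 41 (int (81 - i))"
  proof -
    have "coprime (41 :: int) 61" "coprime (41 :: int) 20"
      by (simp_all add: coprime_iff_gcd_eq_1 gcd_non_0_int)
    then show ?thesis using assms by auto
  qed
  ultimately show ?thesis by (simp add: coprime_dvd_mult_right_iff)
qed

text \<open>
  One level is enough here, since \<open>41\<^sup>2\<close> exceeds all odd numbers that occur. At the two critical
  indices the weight contributes a factor \<open>41\<close>, at all others the summands of both rows are good
  enough separately.
\<close>
lemma padic_ge_combination_41:
  fixes c q :: int
  assumes "q \<noteq> 0" "j \<in> {1, 2}"
  shows "padic_ge 41 (- 1) (of_int q *
    (poly (R_entry 40 1 j) (of_int c / of_int q) - 2 * poly (R_entry 40 0 j) (of_int c / of_int q)))"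
  unfolding R_entry_combination
proof (rule padic_ge_row_comb[where K = 1])
  show p: "prime (41 :: nat)" using int_mem_odd_primes_upto_250_iff[of 41] by (simp add: odd_primes_upto_250_def)
  fix i :: nat assume i: "i \<le> 1 + 2 * 40"
  let ?d = "\<lambda>i. int ((1 + 2 * 40) choose i) - 2 * int ((2 * 40) choose i)"
  let ?k = "- 1 - col_exp 40 j 41 i"
  have code: "if int i = 20 \<or> int i = 61 then - 2 \<le> col_code 40 (int j) 41 (int i)
     else - 1 \<le> term_code 40 1 (int j) 41 (int i) \<and>
       (if int i = 81 then True else - 1 \<le> term_code 40 0 (int j) 41 (int i))"
  proof -
    have "int j \<in> set [1, 2]" "int i \<in> set [0..81]" using i assms(2) by auto
    then show ?thesis using row_bounds_41 by blast
  qed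
  have col: "col_exp 40 j 41 i = col_code 40 (int j) 41 (int i)"
    using col_exp_eq_code[of 41 40 j i] by simp
  have "padic_ge 41 ?k (of_int ((- 1) ^ i * ?d i))"
  proof (cases "i = 20 \<or> i = 61")
    case True
    then have "int 41 ^ 1 dvd (- 1) ^ i * ?d i" using dvd_41[OF True] by simp
    then have "padic_ge 41 (int 1) (of_int ((- 1) ^ i * ?d i))"
      using p by (rule padic_ge_of_int_power)
    moreover have "- 2 \<le> col_exp 40 j 41 i" using code True unfolding col by auto
    ultimately show ?thesis using p by (elim padic_ge_mono) auto
  next
    case False
    then have code: "- 1 \<le> term_code 40 1 (int j) 41 (int i)" "i \<noteq> 81 \<Longrightarrow> - 1 \<le> term_code 40 0 (int j) 41 (int i)"
      using code by (auto split: if_splits)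
    have "padic_ge 41 (binom_exp (1 + 2 * 40) 41 i) (of_int ((- 1) ^ i * int ((1 + 2 * 40) choose i)))"
      using padic_ge_binomial[OF p, of "1 + 2 * 40" 1 i] i by simp
    moreover have "?k \<le> binom_exp (1 + 2 * 40) 41 i"
      using code(1) term_exp_eq_code[of 41 i 1 40 j] i by (simp add: term_exp_def)
    ultimately have 1: "padic_ge 41 ?k (of_int ((- 1) ^ i * int ((1 + 2 * 40) choose i)))"
      using p by (rule padic_ge_mono)
    have 0: "padic_ge 41 ?k (of_int ((- 1) ^ i * int ((2 * 40) choose i)))"
    proof (cases "i = 81")
      case True
      then show ?thesis using p by (simp add: binomial_eq_0 padic_ge_zero)
    next
      case False
      then have i': "i \<le> 2 * 40" using i by simp
      have "padic_ge 41 (binom_exp (2 * 40) 41 i) (of_int ((- 1) ^ i * int ((2 * 40) choose i)))"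
        using padic_ge_binomial[OF p, of "2 * 40" 1 i] i' by simp
      moreover have "?k \<le> binom_exp (2 * 40) 41 i"
        using code(2)[OF False] term_exp_eq_code[of 41 i 0 40 j] i' by (simp add: term_exp_def)
      ultimately show ?thesis using p by (rule padic_ge_mono)
    qed
    have "padic_ge 41 (0 + ?k) (of_int 2 * of_int ((- 1) ^ i * int ((2 * 40) choose i)))"
      using p 0 by (intro padic_ge_mult padic_ge_of_int)
    then have "padic_ge 41 ?k (of_int ((- 1) ^ i * int ((1 + 2 * 40) choose i))
        - of_int 2 * of_int ((- 1) ^ i * int ((2 * 40) choose i)))"
      using 1 p by (intro padic_ge_diff) simp_all
    then show ?thesis
      by (simp only: of_int_mult of_int_diff right_diff_distrib mult.left_commute)
  qed
  then show "padic_ge 41 (- 1 - (\<Sum>\<nu> = 1..1. col_exp 40 j (41 ^ \<nu>) i)) (of_int ((- 1) ^ i * ?d i))"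
    by simp
qed (use assms in auto)

text \<open>
  The row operation leaves the determinant unchanged and improves the bound for the second row
  from \<open>-2\<close> to \<open>-1\<close>.
\<close>
lemma padic_ge_det_pair_41:
  fixes c q :: int
  assumes "q \<noteq> 0"
  shows "padic_ge 41 (\<Sum>\<nu> = 1..5. m_exp 40 2 {0, 1} (41 ^ \<nu>))
    (of_int q ^ 2 * poly (det (R_mat 40 2 {0, 1})) (of_int c / of_int q))"
proof -
  have p: "prime (41 :: nat)" using int_mem_odd_primes_upto_250_iff[of 41] by (simp add: odd_primes_upto_250_def)
  have zero: "m_exp 40 2 {0, 1} (41 ^ \<nu>) = 0" if "\<nu> \<ge> 2" for \<nu>
  proof (rule m_exp_eq_0)
    have "(41 :: nat) ^ 2 \<le> 41 ^ \<nu>" using that by (intro power_increasing) auto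
    then show "2 * (NN 40 2 + 40) < 41 ^ \<nu>" by (simp add: NN_def)
  qed auto
  have "m_exp 40 2 {0, 1} 41 \<le> - 3"
    using minima_41 m_exp_eq_code[of 41 2 "[0, 1]" 40] by simp
  then have m: "(\<Sum>\<nu> = 1..5. m_exp 40 2 {0, 1} (41 ^ \<nu>)) \<le> - 3"
    using zero[of 2] zero[of 3] zero[of 4] zero[of 5] unfolding sum_1_5 by simp
  have entry: "padic_ge 41 (- 2) (of_int q * poly (R_entry 40 0 j) (of_int c / of_int q))"
    if "j \<in> {1, 2}" for j
  proof (rule padic_ge_mono[OF padic_ge_R_entry_levels])
    have "- 2 \<le> level_bound 40 0 j 41" using minima_41 that by (auto simp: level_bound_def)
    moreover have "level_bound 40 0 j (41 ^ 2) = 0" "level_bound 40 0 j (41 ^ 3) = 0"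
      "level_bound 40 0 j (41 ^ 4) = 0" "level_bound 40 0 j (41 ^ 5) = 0"
      by (simp_all add: level_bound_def)
    ultimately show "- 2 \<le> (\<Sum>\<nu> = 1..5. level_bound 40 0 j (41 ^ \<nu>))"
      unfolding sum_1_5 by simp
  qed (use that assms p in auto)
  let ?r = "\<lambda>a j. poly (R_entry 40 a j) (of_int c / of_int q)"
  have det: "det (R_mat 40 2 {0, 1}) = R_entry 40 0 1 * R_entry 40 1 2 - R_entry 40 0 2 * R_entry 40 1 1"
    by (rule det_R_mat_2) simp
  have "poly (det (R_mat 40 2 {0, 1})) (of_int c / of_int q)
      = ?r 0 1 * (?r 1 2 - 2 * ?r 0 2) - ?r 0 2 * (?r 1 1 - 2 * ?r 0 1)"
    unfolding det by (simp add: algebra_simps)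
  moreover have "padic_ge 41 (\<Sum>\<nu> = 1..5. m_exp 40 2 {0, 1} (41 ^ \<nu>))
      (of_int q ^ 2 * (?r 0 1 * (?r 1 2 - 2 * ?r 0 2) - ?r 0 2 * (?r 1 1 - 2 * ?r 0 1)))"
    by (rule padic_ge_2x2[OF p entry entry padic_ge_combination_41 padic_ge_combination_41])
       (use assms m in auto)
  ultimately show ?thesis by simp
qed

section \<open>The denominator\<close>

lemma m_total_eq_sum:
  assumes "prime p" "odd p" "S \<le> B" "A \<subseteq> {0..S + 2}" "2 * (NN B S + B) \<le> 250"
  shows "m_total B S A p = of_int (\<Sum>\<nu> = 1..5. m_exp B S A (p ^ \<nu>))"
  unfolding m_total_def
  by (rule infsum_prime_powers[OF assms(1) less_power_6[OF assms(1,2,5)]]) (rule m_exp_eq_0[OF _ assms(3,4)])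

text \<open>
  If \<open>p > 250\<close> or \<open>\<nu> > 5\<close>, then \<open>p ^ \<nu> > 250\<close> and both exponents are zero.
\<close>
lemma B_bound_eq_sum:
  assumes "S \<le> B" "A \<subseteq> {0..S + 2}" "2 * (NN B S + B) \<le> 250"
  shows "B_bound B S A = (\<Sum>p | prime p \<and> odd p \<and> p \<le> 250.
    of_int (\<Sum>\<nu> = 1..5. a_exp B S (p ^ \<nu>) - m_exp B S A (p ^ \<nu>)) * ln (real p))"
proof -
  let ?P = "{p. prime p \<and> odd p \<and> p \<le> (250 :: nat)}"
  define g where "g = (\<lambda>(p, \<nu>). real_of_int (a_exp B S (p ^ \<nu>) - m_exp B S A (p ^ \<nu>)) * ln (real p))"
  have g0: "g (p, \<nu>) = 0" if "p ^ \<nu> > 250" for p \<nu>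
    using that assms by (simp add: g_def a_exp_eq_0 m_exp_eq_0)
  have "g (p, \<nu>) = 0" if "prime p" "odd p" "\<nu> \<ge> 1" "(p, \<nu>) \<notin> ?P \<times> {1..5}" for p \<nu>
  proof (cases "p \<le> 250")
    case True
    then have "\<nu> \<ge> Suc 5" using that by auto
    then have "p ^ Suc 5 \<le> p ^ \<nu>" using prime_gt_0_nat[OF that(1)] by (intro power_increasing) auto
    then show ?thesis using less_power_6[OF that(1,2), of 250] by (intro g0) simp
  next
    case False
    have "p ^ 1 \<le> p ^ \<nu>" using prime_gt_0_nat[OF that(1)] that(3) by (intro power_increasing) auto
    then show ?thesis using False by (intro g0) simp
  qed
  then have "g x = 0" if "x \<in> {(p, \<nu>). prime p \<and> odd p \<and> \<nu> \<ge> 1} - ?P \<times> {1..5}" for x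
    using that by (cases x) blast
  moreover have "?P \<times> {1..5} \<subseteq> {(p, \<nu>). prime p \<and> odd p \<and> \<nu> \<ge> 1}" by auto
  ultimately have "B_bound B S A = infsum g (?P \<times> {1..5})"
    unfolding B_bound_def g_def[symmetric] by (intro infsum_cong_neutral) blast+
  also have "\<dots> = sum g (?P \<times> {1..5})" by (rule infsum_finite) simp
  also have "\<dots> = (\<Sum>p\<in>?P. \<Sum>\<nu> = 1..5. g (p, \<nu>))" by (simp add: sum.cartesian_product)
  finally show ?thesis by (simp add: g_def sum_distrib_right)
qed

lemma den_pos: "den x > 0"
  unfolding den_def using quotient_of_denom_pos' .

text \<open>
  Makes the minimal multiplier in the definition of \<open>H_min\<close> the least positive multiple of the
  denominator.
\<close>
lemma mult_of_nat_in_Ints_iff: "of_nat H * x \<in> \<int> \<longleftrightarrow> den x dvd int H"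
proof -
  obtain n m where nm: "quotient_of x = (n, m)" by fastforce
  have m: "m > 0" and x: "x = of_int n / of_int m" and cop: "coprime n m"
    using quotient_of_denom_pos[OF nm] quotient_of_div[OF nm] quotient_of_coprime[OF nm] by auto
  have "of_nat H * x \<in> \<int> \<longleftrightarrow> (\<exists>z. int H * n = z * m)"
  proof
    assume "of_nat H * x \<in> \<int>"
    then obtain z where "of_nat H * x = of_int z" by (elim Ints_cases)
    then have "of_int (int H * n) = (of_int (z * m) :: rat)" using m x by (simp add: field_simps)
    then show "\<exists>z. int H * n = z * m" by (simp only: of_int_eq_iff) blast
  next
    assume "\<exists>z. int H * n = z * m"
    then obtain z where "int H * n = z * m" by blast
    then have "of_int (int H * n) = (of_int (z * m) :: rat)" by (simp only:)
    then have "of_nat H * x = of_int z" using m unfolding x by (simp add: field_simps)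
    then show "of_nat H * x \<in> \<int>" by simp
  qed
  also have "\<dots> \<longleftrightarrow> m dvd int H * n" by (auto simp: dvd_def mult.commute)
  also have "\<dots> \<longleftrightarrow> m dvd int H" using cop by (simp add: coprime_dvd_mult_left_iff coprime_commute)
  finally show ?thesis by (simp add: den_def nm)
qed

lemma H_min_eq_den: "int (H_min B S A a q) = den (of_int q ^ S * poly (q_hat B S A) (of_int a / of_int q))"
proof -
  define y where "y = of_int q ^ S * poly (q_hat B S A) (of_int a / of_int q)"
  have "H_min B S A a q = (LEAST H. H > 0 \<and> of_nat H * y \<in> \<int>)"
    unfolding H_min_def y_def by (simp add: mult_ac)
  also have "\<dots> = nat (den y)"
  proof (rule Least_equality)
    show "nat (den y) > 0 \<and> of_nat (nat (den y)) * y \<in> \<int>"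
      using den_pos[of y] by (simp only: mult_of_nat_in_Ints_iff) simp
  next
    fix H assume "H > 0 \<and> of_nat H * y \<in> \<int>"
    then show "nat (den y) \<le> H"
      unfolding mult_of_nat_in_Ints_iff using zdvd_imp_le[of "den y" "int H"] by linarith
  qed
  finally show ?thesis using den_pos[of y] by (simp add: y_def)
qed

lemma den_dvd_prod:
  fixes e :: "nat \<Rightarrow> nat"
  assumes "finite P" "\<And>p. p \<in> P \<Longrightarrow> prime p"
    and "\<And>p. p \<in> P \<Longrightarrow> padic_ge p (- int (e p)) x"
    and "\<And>p. prime p \<Longrightarrow> p \<notin> P \<Longrightarrow> padic_ge p 0 x"
  shows "nat (den x) dvd (\<Prod>p\<in>P. p ^ e p)"
proof (rule multiplicity_le_imp_dvd)
  fix p :: nat assume p: "prime p"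
  have "multiplicity p (nat (den x)) = multiplicity (int p) (den x)"
    using multiplicity_int[OF p, of "nat (den x)"] den_pos[of x] by simp
  also have "\<dots> \<le> (if p \<in> P then e p else 0)"
    using multiplicity_den_le[of p _ x] assms(3)[of p] assms(4)[of p] multiplicity_den_le[of p 0 x] p by auto
  also have "\<dots> = multiplicity p (\<Prod>p\<in>P. p ^ e p)"
    using assms(1,2) p by (simp add: multiplicity_prod_prime_powers)
  finally show "multiplicity p (nat (den x)) \<le> multiplicity p (\<Prod>p\<in>P. p ^ e p)" .
qed (use den_pos[of x] in simp)

lemma padic_ge_q_hat:
  fixes a q :: int
  assumes "prime p" "padic_ge p k (of_int q ^ S * poly (det (R_mat B S A)) (of_int a / of_int q))"
  shows "padic_ge p (k - (int (multiplicity p (Pi_prod B S)) - int (multiplicity p (F_fac (2 * B)))))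
    (of_int q ^ S * poly (q_hat B S A) (of_int a / of_int q))"
proof -
  have "padic_ge p (int (multiplicity p (F_fac (2 * B))) + (- int (multiplicity p (Pi_prod B S)) + k))
    (of_nat (F_fac (2 * B)) * (1 / of_nat (Pi_prod B S) *
      (of_int q ^ S * poly (det (R_mat B S A)) (of_int a / of_int q))))"
    using assms Pi_prod_pos by (intro padic_ge_mult padic_ge_of_nat padic_ge_inverse) auto
  then show ?thesis by (simp add: q_hat_def algebra_simps)
qed

lemma multiplicity_2_Pi_prod: "multiplicity 2 (Pi_prod B S) = 0"
proof (rule not_dvd_imp_multiplicity_0)
  have "odd (Pi_fac B i)" for i
    unfolding Pi_fac_def by (induction B) (simp_all add: prod.nat_ivl_Suc')
  then have "odd (\<Prod>i<n. Pi_fac B i)" for n by (induction n) auto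
  then show "odd (Pi_prod B S)" by (simp add: Pi_prod_def)
qed

text \<open>
  The normalising factor has valuation \<open>-\<Sum>a\<close> by part (i), so every odd prime \<open>p \<noteq> p\<^sub>0\<close> divides the
  denominator at most \<open>\<Sum>(a - m)\<close> times, and \<open>p\<^sub>0\<close> at least one time fewer. The
  hypothesis on the signs ensures that these numbers are exponents of an integer.
\<close>
lemma ln_den_q_hat_le:
  fixes B S :: nat and as :: "nat list" and c q :: int
  defines "y \<equiv> of_int q ^ S * poly (q_hat B S (set as)) (of_int c / of_int q)"
  defines "x \<equiv> of_int q ^ S * poly (det (R_mat B S (set as))) (of_int c / of_int q)"
  assumes SB: "S \<le> B" and as: "set as \<subseteq> {0..S + 2}" and small: "2 * (NN B S + B) \<le> 250"
    and p0: "prime p\<^sub>0" "odd p\<^sub>0" "p\<^sub>0 \<le> 250"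
    and nonneg: "\<And>p. prime p \<Longrightarrow> odd p \<Longrightarrow> p \<le> 250 \<Longrightarrow>
      (if p = p\<^sub>0 then 1 else 0) \<le> (\<Sum>\<nu> = 1..5. a_exp B S (p ^ \<nu>) - m_exp B S (set as) (p ^ \<nu>))"
    and val: "\<And>p. prime p \<Longrightarrow> odd p \<Longrightarrow>
      padic_ge p ((\<Sum>\<nu> = 1..5. m_exp B S (set as) (p ^ \<nu>)) + (if p = p\<^sub>0 then 1 else 0)) x"
    and val2: "padic_ge 2 0 x"
  shows "ln (real_of_int (den y)) \<le> B_bound B S (set as) - ln (real p\<^sub>0)"
proof -
  define P where "P = {p. prime p \<and> odd p \<and> p \<le> (250 :: nat)}"
  define E where "E p = (\<Sum>\<nu> = 1..5. a_exp B S (p ^ \<nu>) - m_exp B S (set as) (p ^ \<nu>))" for p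
  define e where "e p = nat (E p - (if p = p\<^sub>0 then 1 else 0))" for p
  have P: "finite P" "\<And>p. p \<in> P \<Longrightarrow> prime p" by (auto simp: P_def)
  have y: "padic_ge p (- (E p - (if p = p\<^sub>0 then 1 else 0))) y" if "prime p" "odd p" for p
  proof -
    have "int (multiplicity p (Pi_prod B S)) - int (multiplicity p (F_fac (2 * B)))
        = (\<Sum>\<nu> = 1..5. a_exp B S (p ^ \<nu>))"
      using sum_a_exp[OF that(1) less_power_6[OF that small]] by simp
    then show ?thesis
      using padic_ge_q_hat[OF that(1) val[OF that, unfolded x_def]]
      unfolding y_def E_def by (simp add: sum_subtractf algebra_simps)
  qed
  have "nat (den y) dvd (\<Prod>p\<in>P. p ^ e p)"
  proof (rule den_dvd_prod[OF P])
    fix p assume "p \<in> P"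
    then show "padic_ge p (- int (e p)) y"
      using y[of p] nonneg[of p] by (auto simp: P_def e_def E_def)
  next
    fix p :: nat assume p: "prime p" "p \<notin> P"
    show "padic_ge p 0 y"
    proof (cases "p = 2")
      case True
      then have "padic_ge 2 (int (multiplicity 2 (F_fac (2 * B)))) y"
        using padic_ge_q_hat[OF _ val2[unfolded x_def]] unfolding y_def
        by (simp add: multiplicity_2_Pi_prod)
      then show ?thesis using True by (auto elim: padic_ge_mono)
    next
      case False
      then have odd: "odd p" using p(1) primes_dvd_imp_eq two_is_prime_nat by blast
      then have "p > 250" using p by (simp add: P_def)
      have "a_exp B S (p ^ \<nu>) - m_exp B S (set as) (p ^ \<nu>) = 0" if "\<nu> \<in> {1..5}" for \<nu>
      proof -
        have "p \<le> p ^ \<nu>"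
          using that prime_gt_0_nat[OF p(1)] by (intro self_le_power) auto
        then have "2 * (NN B S + B) < p ^ \<nu>" using small \<open>p > 250\<close> by linarith
        then show ?thesis using SB as by (simp only: a_exp_eq_0 m_exp_eq_0)
      qed
      then have "E p = 0" unfolding E_def by (intro sum.neutral) blast
      moreover have "p \<noteq> p\<^sub>0" using p0 \<open>p > 250\<close> by simp
      ultimately show ?thesis using y[OF p(1) odd] by simp
    qed
  qed
  moreover have W: "(\<Prod>p\<in>P. p ^ e p) > 0"
    using P prime_gt_0_nat by (intro prod_pos) auto
  ultimately have "nat (den y) \<le> (\<Prod>p\<in>P. p ^ e p)" by (intro dvd_imp_le)
  then have "real (nat (den y)) \<le> real (\<Prod>p\<in>P. p ^ e p)" by (rule of_nat_mono)
  then have "ln (real_of_int (den y)) \<le> ln (real (\<Prod>p\<in>P. p ^ e p))"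
    using den_pos[of y] by (subst ln_le_cancel_iff) (auto simp: W)
  also have "\<dots> = (\<Sum>p\<in>P. real (e p) * ln (real p))"
    using P prime_gt_0_nat by (simp add: ln_prod ln_realpow)
  also have "\<dots> = (\<Sum>p\<in>P. of_int (E p) * ln (real p) - (if p = p\<^sub>0 then ln (real p) else 0))"
    using nonneg by (intro sum.cong refl) (auto simp: e_def E_def P_def algebra_simps)
  also have "\<dots> = B_bound B S (set as) - ln (real p\<^sub>0)"
    using P(1) p0 B_bound_eq_sum[OF SB as small]
    by (simp add: sum_subtractf E_def sum.delta P_def)
  finally show ?thesis .
qed

section \<open>Fixed-point logarithms\<close>

text \<open>
  With \<open>c = 2n - 1\<close> and \<open>y = 1 / c\<close> one has \<open>n / (n - 1) = (1 + y) / (1 - y)\<close>, so that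
  \<open>ln (n / (n - 1)) = 2 (y + y\<^sup>3/3 + y\<^sup>5/5 + \<dots>)\<close>. Six terms are kept, in units of \<open>10\<^sup>-\<^sup>1\<^sup>0\<close>.
\<close>
definition ln_step :: "int \<Rightarrow> int" where
  "ln_step n = (let c = 2 * n - 1; T = 20000000000 in
     T div c + T div (3 * c ^ 3) + T div (5 * c ^ 5) + T div (7 * c ^ 7) + T div (9 * c ^ 9)
     + T div (11 * c ^ 11))"

definition ln_fix :: "int \<Rightarrow> int" where
  "ln_fix n = (\<Sum>m = 2..n. ln_step m)"

text \<open>
  Six roundings cost at most \<open>6\<close> units. The tail of the series is below \<open>4\<close> units for \<open>c \<ge> 5\<close>;
  only \<open>c = 3\<close>, that is \<open>ln 2\<close>, has a larger one.
\<close>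
lemma ln_step_bounds:
  assumes "n \<ge> 2"
  shows "of_int (ln_step n) \<le> 10 ^ 10 * (ln (real_of_int n) - ln (of_int (n - 1)))"
    and "10 ^ 10 * (ln (real_of_int n) - ln (of_int (n - 1)))
      \<le> of_int (ln_step n) + (if n = 2 then 2000 else 10)"
proof -
  define c where "c = 2 * n - 1"
  define y where "y = 1 / real_of_int c"
  define x where "x = real_of_int n / of_int (n - 1)"
  have c: "c \<ge> 3" using assms by (simp add: c_def)
  have x: "x > 1" using assms by (simp add: x_def)
  have "x - 1 = 1 / of_int (n - 1)" "x + 1 = of_int c / of_int (n - 1)"
    using assms by (simp_all add: x_def c_def field_simps)
  then have y: "(x - 1) / (x + 1) = y"
    using assms by (simp add: y_def)
  have ln_x: "ln x = ln (real_of_int n) - ln (of_int (n - 1))"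
    using assms unfolding x_def by (intro ln_divide_pos) auto
  define A where "A = (\<Sum>k<6. 2 * y ^ (2 * k + 1) / of_nat (2 * k + 1))"
  define d where "d = y ^ (2 * 6 + 1) / (1 - y ^ 2) / of_nat (2 * 6 + 1)"
  have "ln x \<in> {A..A + 2 * d}"
    using ln_approx_bounds[OF x, of 6] unfolding y A_def d_def .
  then have ln_bounds: "A \<le> ln x" "ln x \<le> A + 2 * d" by simp_all
  have A: "10 ^ 10 * A = real_of_int 20000000000 / of_int c + real_of_int 20000000000 / of_int (3 * c ^ 3)
      + real_of_int 20000000000 / of_int (5 * c ^ 5)
      + real_of_int 20000000000 / of_int (7 * c ^ 7) + real_of_int 20000000000 / of_int (9 * c ^ 9)
      + real_of_int 20000000000 / of_int (11 * c ^ 11)"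
  proof -
    have "{..<6 :: nat} = {0, 1, 2, 3, 4, 5}" by auto
    then show ?thesis unfolding A_def by (simp add: y_def power_divide flip: power_Suc)
  qed
  have lower: "of_int (20000000000 div b) \<le> real_of_int 20000000000 / of_int b"
    and upper: "real_of_int 20000000000 / of_int b \<le> of_int (20000000000 div b) + 1" for b :: int
    using real_of_int_div4[of 20000000000 b] real_of_int_div3[of 20000000000 b] by simp_all
  have "of_int (ln_step n) \<le> 10 ^ 10 * A"
    unfolding A ln_step_def Let_def c_def[symmetric] of_int_add
    by (intro add_mono lower)
  also have "\<dots> \<le> 10 ^ 10 * ln x" using ln_bounds by simp
  finally show "of_int (ln_step n) \<le> 10 ^ 10 * (ln (real_of_int n) - ln (of_int (n - 1)))"
    by (simp only: ln_x)
  have "10 ^ 10 * A \<le> of_int (ln_step n) + 6"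
    unfolding A ln_step_def Let_def c_def[symmetric] of_int_add
    using upper[of c] upper[of "3 * c ^ 3"] upper[of "5 * c ^ 5"] upper[of "7 * c ^ 7"]
      upper[of "9 * c ^ 9"] upper[of "11 * c ^ 11"] by linarith
  moreover have "10 ^ 10 * (2 * d) \<le> (if n = 2 then 1994 else 4)"
  proof (cases "n = 2")
    case True
    then have "y = 1 / 3" by (simp add: y_def c_def)
    then show ?thesis using True unfolding d_def \<open>y = 1 / 3\<close> by (simp add: power_divide)
  next
    case False
    then have "c \<ge> 5" using assms unfolding c_def by linarith
    then have "real_of_int c \<ge> 5" by simp
    then have y5: "0 \<le> y" "y \<le> 1 / 5" unfolding y_def by (simp_all add: field_simps)
    then have "y ^ 13 \<le> (1 / 5) ^ 13" "y ^ 2 \<le> (1 / 5) ^ 2" by (intro power_mono; simp)+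
    moreover have "(1 / 5) ^ 2 < (1 :: real)" by (simp add: power_divide)
    ultimately have "y ^ 13 / (1 - y ^ 2) \<le> (1 / 5) ^ 13 / (1 - (1 / 5) ^ 2)"
      using y5 by (intro frac_le) auto
    then have "20000000000 / 13 * (y ^ 13 / (1 - y ^ 2))
        \<le> 20000000000 / 13 * ((1 / 5) ^ 13 / (1 - (1 / 5) ^ 2))"
      by (rule mult_left_mono) simp
    also have "\<dots> \<le> 4" by (simp add: power_divide)
    finally have "10 ^ 10 * (2 * d) \<le> 4" by (simp add: d_def algebra_simps)
    then show ?thesis using False by (simp only: if_False)
  qed
  ultimately have "10 ^ 10 * ln x \<le> of_int (ln_step n) + 6 + (if n = 2 then 1994 else 4)"
    using mult_left_mono[OF ln_bounds(2), of "10 ^ 10"] by (simp add: distrib_left)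
  then show "10 ^ 10 * (ln (real_of_int n) - ln (of_int (n - 1)))
      \<le> of_int (ln_step n) + (if n = 2 then 2000 else 10)"
    unfolding ln_x[symmetric] by (cases "n = 2") simp_all
qed

lemma ln_fix_bounds:
  assumes "n \<ge> 2"
  shows "of_int (ln_fix n) \<le> 10 ^ 10 * ln (real_of_int n)"
    and "10 ^ 10 * ln (real_of_int n) \<le> of_int (ln_fix n) + (2000 + 10 * of_int n)"
proof -
  have "of_int (ln_fix n) \<le> 10 ^ 10 * ln (real_of_int n) \<and>
    10 ^ 10 * ln (real_of_int n) \<le> of_int (ln_fix n) + (2000 + 10 * of_int n)"
    using assms
  proof (induction n rule: int_ge_induct)
    case base
    then show ?case using ln_step_bounds[of 2] by (simp add: ln_fix_def)
  next
    case (step n)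
    have "{2..n + 1} = insert (n + 1) {2..n}" using step.hyps by auto
    then have "ln_fix (n + 1) = ln_step (n + 1) + ln_fix n" by (simp add: ln_fix_def)
    then show ?case using ln_step_bounds[of "n + 1"] step by (simp add: algebra_simps)
  qed
  then show "of_int (ln_fix n) \<le> 10 ^ 10 * ln (real_of_int n)"
    "10 ^ 10 * ln (real_of_int n) \<le> of_int (ln_fix n) + (2000 + 10 * of_int n)" by auto
qed

text \<open>
  Computes the logarithms of an increasing list in a single pass, each from its predecessor.
\<close>
fun ln_chain :: "int \<Rightarrow> int \<Rightarrow> int list \<Rightarrow> int list" where
  "ln_chain n l [] = []"
| "ln_chain n l (p # ps) = (let l' = l + sum_list (map ln_step [n + 1..p]) in l' # ln_chain p l' ps)"

lemma ln_chain_eq: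
  assumes "n \<ge> 1" "sorted (n # ps)"
  shows "ln_chain n (ln_fix n) ps = map ln_fix ps"
  using assms
proof (induction ps arbitrary: n)
  case (Cons p ps)
  have "{2..p} = {2..n} \<union> {n + 1..p}" using Cons.prems by auto
  then have "ln_fix p = ln_fix n + sum ln_step {n + 1..p}"
    unfolding ln_fix_def by (simp only:) (rule sum.union_disjoint, auto)
  also have "sum ln_step {n + 1..p} = sum_list (map ln_step [n + 1..p])"
    by (simp add: sum_list_distinct_conv_sum_set)
  finally have "ln_fix n + sum_list (map ln_step [n + 1..p]) = ln_fix p" by simp
  then show ?case using Cons by (simp add: Let_def)
qed simp

section \<open>From tables of integers to the bound\<close>

text \<open>
  The logarithms up to \<open>250\<close> are known up to \<open>2000 + 10 * 250 = 4500\<close> units of \<open>10\<^sup>-\<^sup>1\<^sup>0\<close>, and the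
  coefficients are nonnegative.
\<close>
lemma B_bound_numeric:
  fixes B S :: nat and as :: "nat list" and es ls :: "int list"
  assumes S: "S = 1 \<or> S = 2" and dist: "distinct as"
    and SB: "S \<le> B" and as: "set as \<subseteq> {0..S + 2}" and small: "2 * (NN B S + B) \<le> 250"
    and es: "map (gap_code (int B) (int S) (map int as)) odd_primes_upto_250 = es"
    and ls: "map ln_fix odd_primes_upto_250 = ls"
    and pos: "\<forall>e\<in>set es. 0 \<le> e"
  shows "of_int (sum_list (map2 (*) es ls)) \<le> 10 ^ 10 * B_bound B S (set as)"
    and "10 ^ 10 * B_bound B S (set as) \<le> of_int (sum_list (map2 (*) es ls) + 4500 * sum_list es)"
proof -
  define g where "g = gap_code (int B) (int S) (map int as)"
  have dist_P: "distinct odd_primes_upto_250" by (simp add: odd_primes_upto_250_def)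
  have *: "sum_list (map f odd_primes_upto_250) = (\<Sum>n\<in>set odd_primes_upto_250. f n)" for f :: "int \<Rightarrow> int"
    using dist_P by (simp add: sum_list_distinct_conv_sum_set)
  have "map2 (*) es ls = map (\<lambda>n. g n * ln_fix n) odd_primes_upto_250"
    unfolding es[symmetric] ls[symmetric] g_def by (simp add: map2_map_map)
  then have sum1: "sum_list (map2 (*) es ls) = (\<Sum>n\<in>set odd_primes_upto_250. g n * ln_fix n)"
    by (simp only: *)
  have sum2: "sum_list es = (\<Sum>n\<in>set odd_primes_upto_250. g n)"
    unfolding es[symmetric] g_def by (rule *)
  have set_P: "set odd_primes_upto_250 = int ` {p. prime p \<and> odd p \<and> p \<le> 250}"
  proof
    show "set odd_primes_upto_250 \<subseteq> int ` {p. prime p \<and> odd p \<and> p \<le> 250}"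
    proof
      fix n assume n: "n \<in> set odd_primes_upto_250"
      then have "n > 0" using odd_primes_upto_250_prime(3) by fastforce
      then show "n \<in> int ` {p. prime p \<and> odd p \<and> p \<le> 250}"
        using n int_mem_odd_primes_upto_250_iff[of "nat n"] by (intro image_eqI[of _ _ "nat n"]) auto
    qed
  qed (auto simp only: int_mem_odd_primes_upto_250_iff)
  have "B_bound B S (set as) = (\<Sum>p | prime p \<and> odd p \<and> p \<le> 250. of_int (g (int p)) * ln (real_of_int (int p)))"
    unfolding B_bound_eq_sum[OF SB as small] g_def
    by (intro sum.cong refl) (simp add: gap_code_eq[OF _ S dist as SB small])
  also have "\<dots> = (\<Sum>n\<in>set odd_primes_upto_250. of_int (g n) * ln (real_of_int n))"
    unfolding set_P by (subst sum.reindex) auto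
  finally have BB: "10 ^ 10 * B_bound B S (set as) = (\<Sum>n\<in>set odd_primes_upto_250. of_int (g n) * (10 ^ 10 * ln (real_of_int n)))"
    by (simp only: sum_distrib_left mult.left_commute)
  have g: "g n \<ge> 0" if "n \<in> set odd_primes_upto_250" for n
    using pos that unfolding es[symmetric] g_def by auto
  have n: "2 \<le> n" "n \<le> 250" if "n \<in> set odd_primes_upto_250" for n
    using odd_primes_upto_250_prime(3,4)[OF that] by simp_all
  have "of_int (g n * ln_fix n) \<le> real_of_int (g n) * (10 ^ 10 * ln (real_of_int n))"
    and "real_of_int (g n) * (10 ^ 10 * ln (real_of_int n)) \<le> of_int (g n * ln_fix n + 4500 * g n)"
    if "n \<in> set odd_primes_upto_250" for n
  proof -
    show "of_int (g n * ln_fix n) \<le> real_of_int (g n) * (10 ^ 10 * ln (real_of_int n))"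
      unfolding of_int_mult using g[OF that] ln_fix_bounds(1)[of n] n[OF that] by (intro mult_left_mono) auto
    have "real_of_int (g n) * (10 ^ 10 * ln (real_of_int n)) \<le> of_int (g n) * of_int (ln_fix n + 4500)"
      using g[OF that] ln_fix_bounds(2)[of n] n[OF that] by (intro mult_left_mono) auto
    then show "real_of_int (g n) * (10 ^ 10 * ln (real_of_int n)) \<le> of_int (g n * ln_fix n + 4500 * g n)"
      by (simp add: algebra_simps)
  qed
  then show "of_int (sum_list (map2 (*) es ls)) \<le> 10 ^ 10 * B_bound B S (set as)"
    and "10 ^ 10 * B_bound B S (set as) \<le> of_int (sum_list (map2 (*) es ls) + 4500 * sum_list es)"
    unfolding sum1 sum2 BB sum_distrib_left of_int_sum sum.distrib[symmetric]
    by (auto simp: sum_distrib_left simp flip: sum.distrib intro!: sum_mono)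
qed

text \<open>
  The conclusion of the theorem for one choice of the parameters.
\<close>
definition denominator_bound_holds ::
  "nat \<Rightarrow> nat \<Rightarrow> nat set \<Rightarrow> real \<Rightarrow> int \<Rightarrow> int \<Rightarrow> bool" where
  "denominator_bound_holds B S A v a q \<longleftrightarrow>
     (\<forall>p. prime p \<and> odd p \<longrightarrow>
        vp p (of_nat (Pi_prod B S)) - vp p (of_nat (F_fac (2 * B))) = ereal (a_total B S p))
   \<and> (\<forall>p. prime p \<and> odd p \<longrightarrow>
        vp p (of_int q ^ S * poly (det (R_mat B S A)) (of_int a / of_int q)) \<ge> ereal (m_total B S A p))
   \<and> real_of_int (round (10 * B_bound B S A)) / 10 = v
   \<and> B_bound B S A > ln (real_of_int (den (of_int q ^ S * poly (q_hat B S A) (of_int a / of_int q))))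
   \<and> v > ln (real_of_int (den (of_int q ^ S * poly (q_hat B S A) (of_int a / of_int q))))
   \<and> int (H_min B S A a q) = den (of_int q ^ S * poly (q_hat B S A) (of_int a / of_int q))
   \<and> ln (real (H_min B S A a q)) \<le> B_bound B S A"

text \<open>
  The value \<open>\<B>\<close> lies within \<open>1/20\<close> of \<open>V / 10\<close>, and the denominator falls short of \<open>exp \<B>\<close> by a
  factor \<open>p\<^sub>0 \<ge> 3 > e\<close>. Hence the comparison with the rounded value needs no separate estimate.
\<close>
lemma denominator_bound_from_tables:
  fixes B S :: nat and as :: "nat list" and es ls :: "int list" and a q V :: int
  defines "x \<equiv> of_int q ^ S * poly (det (R_mat B S (set as))) (of_int a / of_int q)"
  defines "y \<equiv> of_int q ^ S * poly (q_hat B S (set as)) (of_int a / of_int q)"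
  assumes S: "S = 1 \<or> S = 2" and dist: "distinct as"
    and SB: "S \<le> B" and as: "set as \<subseteq> {0..S + 2}" and small: "2 * (NN B S + B) \<le> 250"
    and es: "map (gap_code (int B) (int S) (map int as)) odd_primes_upto_250 = es"
    and ls: "map ln_fix odd_primes_upto_250 = ls"
    and pos: "\<forall>e\<in>set es. 0 \<le> e"
    and p0: "(int p\<^sub>0, e\<^sub>0) \<in> set (zip odd_primes_upto_250 es)" "e\<^sub>0 \<ge> 1"
    and val: "\<And>p. prime p \<Longrightarrow> odd p \<Longrightarrow>
      padic_ge p ((\<Sum>\<nu> = 1..5. m_exp B S (set as) (p ^ \<nu>)) + (if p = p\<^sub>0 then 1 else 0)) x"
    and val2: "padic_ge 2 0 x"
    and lower: "10 ^ 9 * V - 5 * 10 ^ 8 < sum_list (map2 (*) es ls)"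
    and upper: "sum_list (map2 (*) es ls) + 4500 * sum_list es < 10 ^ 9 * V + 5 * 10 ^ 8"
  shows "denominator_bound_holds B S (set as) (of_int V / 10) a q"
  unfolding denominator_bound_holds_def x_def [symmetric] y_def [symmetric]
proof (intro conjI allI impI)
  fix p :: nat assume p: "prime p \<and> odd p"
  show "vp p (of_nat (Pi_prod B S)) - vp p (of_nat (F_fac (2 * B))) = ereal (a_total B S p)"
    using p small by (intro vp_Pi_prod_minus_vp_F_fac[where K = 5] less_power_6) auto
  have "padic_ge p (\<Sum>\<nu> = 1..5. m_exp B S (set as) (p ^ \<nu>)) x"
    using p by (intro padic_ge_mono[OF val]) auto
  then have "vp p x \<ge> ereal (of_int (\<Sum>\<nu> = 1..5. m_exp B S (set as) (p ^ \<nu>)))"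
    using p by (intro vp_ge) auto
  then show "vp p x \<ge> ereal (m_total B S (set as) p)"
    using m_total_eq_sum[OF conjunct1[OF p] conjunct2[OF p] SB as small] by (simp only:)
next
  define E where "E p = (\<Sum>\<nu> = 1..5. a_exp B S (p ^ \<nu>) - m_exp B S (set as) (p ^ \<nu>))" for p
  have E: "E p = gap_code (int B) (int S) (map int as) (int p)" if "odd p" for p
    unfolding E_def gap_code_eq[OF that S dist as SB small] ..
  have p0_mem: "int p\<^sub>0 \<in> set odd_primes_upto_250" using p0(1) by (rule set_zip_leftD)
  then have p0_prime: "prime p\<^sub>0" "odd p\<^sub>0" "p\<^sub>0 \<le> 250" unfolding int_mem_odd_primes_upto_250_iff by auto
  have "zip odd_primes_upto_250 es = map (\<lambda>n. (n, gap_code (int B) (int S) (map int as) n)) odd_primes_upto_250"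
    unfolding es[symmetric] by (simp add: zip_map2 zip_same_conv_map)
  then have "gap_code (int B) (int S) (map int as) (int p\<^sub>0) \<ge> 1" using p0 by auto
  then have E0: "E p\<^sub>0 \<ge> 1" using p0_prime by (simp add: E)
  have E_nonneg: "E p \<ge> 0" if "prime p" "odd p" "p \<le> 250" for p
  proof -
    have "int p \<in> set odd_primes_upto_250" unfolding int_mem_odd_primes_upto_250_iff using that by blast
    then show ?thesis using pos that unfolding E[OF that(2)] es[symmetric] by simp
  qed
  have den_le: "ln (real_of_int (den y)) \<le> B_bound B S (set as) - ln (real p\<^sub>0)"
    unfolding y_def
  proof (rule ln_den_q_hat_le[OF SB as small p0_prime _ val[unfolded x_def] val2[unfolded x_def]])
    show "(if p = p\<^sub>0 then 1 else 0) \<le> (\<Sum>\<nu> = 1..5. a_exp B S (p ^ \<nu>) - m_exp B S (set as) (p ^ \<nu>))"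
      if "prime p" "odd p" "p \<le> 250" for p
      using E_nonneg[OF that] E0 unfolding E_def by simp
  qed
  have ln_p0: "ln (real p\<^sub>0) \<ge> 1"
  proof -
    have "real p\<^sub>0 \<ge> 3" using odd_primes_upto_250_prime(3)[OF p0_mem] by linarith
    then have "exp 1 \<le> real p\<^sub>0" using exp_le by linarith
    then show ?thesis using ln_ge_iff[of "real p\<^sub>0" 1] \<open>real p\<^sub>0 \<ge> 3\<close> by simp
  qed
  note numeric = B_bound_numeric[OF S dist SB as small es ls pos]
  have "real_of_int (10 ^ 9 * V - 5 * 10 ^ 8) < 10 ^ 10 * B_bound B S (set as)"
    using lower numeric(1) by linarith
  moreover have "10 ^ 10 * B_bound B S (set as) < real_of_int (10 ^ 9 * V + 5 * 10 ^ 8)"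
    using upper numeric(2) by linarith
  ultimately have B: "of_int V - 1 / 2 < 10 * B_bound B S (set as)" "10 * B_bound B S (set as) < of_int V + 1 / 2"
    by simp_all
  then have "round (10 * B_bound B S (set as)) = V"
    by (intro round_unique) linarith+
  then show "real_of_int (round (10 * B_bound B S (set as))) / 10 = of_int V / 10" by simp
  show B_gt: "B_bound B S (set as) > ln (real_of_int (den y))"
    using den_le ln_p0 by linarith
  show "of_int V / 10 > ln (real_of_int (den y))"
    using den_le ln_p0 B by linarith
  show H: "int (H_min B S (set as) a q) = den y"
    unfolding y_def by (rule H_min_eq_den)
  then have "real (H_min B S (set as) a q) = real_of_int (den y)"
    by (metis of_int_of_nat_eq)
  then show "ln (real (H_min B S (set as) a q)) \<le> B_bound B S (set as)"
    using B_gt by simp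
qed

section \<open>Numerical tables\<close>

text \<open>
  The values \<open>10\<^sup>1\<^sup>0 ln p\<close> for the odd primes \<open>p\<close> up to \<open>250\<close>, rounded down with a small error.
\<close>
definition ln_table :: "int list" where
  "ln_table = [10986121813, 16094378046, 19459100407, 23978951636, 25649492479, 28332132339,
     29444388687, 31354941050, 33672957180, 34339870922, 36109177993, 37135719527,
     37612000014, 38501474867, 39702917976, 40775373271, 41108737472, 42046925017,
     42626797590, 42904593228, 43694477336, 44188404886, 44886362501, 45747108580,
     46151203958, 46347288669, 46728287126, 46913477601, 47273876961, 48441869622,
     48751971985, 49199808007, 49344738078, 50039461798, 50172797105, 50562456783,
     50937500731, 51179936843, 51532914660, 51873856767, 51984969020, 52522732977,
     52626900583, 52832035978, 52933046936, 53518580012, 54071716378, 54249498834,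
     54337218692, 54510383188, 54764634167, 54847967980]"

lemma ln_fix_table: "map ln_fix odd_primes_upto_250 = ln_table"
proof -
  have "ln_chain 1 0 odd_primes_upto_250 = ln_table" by code_simp
  moreover have "ln_chain 1 (ln_fix 1) odd_primes_upto_250 = map ln_fix odd_primes_upto_250"
    by (rule ln_chain_eq) (simp_all add: odd_primes_upto_250_def)
  moreover have "ln_fix 1 = 0" by (simp add: ln_fix_def)
  ultimately show ?thesis by simp
qed

text \<open>
  For each instance, labelled by \<open>B\<close>: the exponents \<open>\<Sum>(a - m)\<close> in the order of the list of primes,
  the resulting enclosure of \<open>10\<^sup>1\<^sup>0 \<B>\<close>, and the prime \<open>p\<^sub>0\<close> with room to spare. For \<open>S = 1\<close> this
  prime lies above the largest odd number \<open>2(a+2B)+1\<close> in the denominators of the partial sums.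
\<close>
definition gaps_20 :: "int list" where
  "gaps_20 = [551, 266, 197, 114, 97, 77, 69, 61, 59, 58, 52, 48, 43, 42, 42, 42, 42, 42, 42, 42, 42,
     42, 40, 32, 28, 26, 22, 20, 16, 2, 0, 0, 0, 0, 0, 0, 0, 0, 0, 0, 0, 0, 0, 0, 0, 0, 0, 0,
     0, 0, 0, 0]"

lemma gap_code_20: "map (gap_code 20 1 [0]) odd_primes_upto_250 = gaps_20"
  by code_simp

lemma gaps_20:
  "(\<forall>e\<in>set gaps_20. 0 \<le> e) \<and> (83, 42) \<in> set (zip odd_primes_upto_250 gaps_20) \<and>
   10 ^ 9 * 59121 - 5 * 10 ^ 8 < sum_list (map2 (*) gaps_20 ln_table) \<and>
   sum_list (map2 (*) gaps_20 ln_table) + 4500 * sum_list gaps_20 < 10 ^ 9 * 59121 + 5 * 10 ^ 8"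
  by code_simp

lemma slack_20: "m_code 20 1 [0] 83 < row_code 20 0 1 83"
  by code_simp

definition gaps_21 :: "int list" where
  "gaps_21 = [595, 296, 212, 130, 104, 83, 75, 67, 59, 62, 56, 52, 49, 44, 44, 44, 44, 44, 44, 44, 44,
     44, 44, 38, 34, 32, 28, 26, 22, 8, 4, 0, 0, 0, 0, 0, 0, 0, 0, 0, 0, 0, 0, 0, 0, 0, 0, 0,
     0, 0, 0, 0]"

lemma gap_code_21: "map (gap_code 21 1 [1]) odd_primes_upto_250 = gaps_21"
  by code_simp

lemma gaps_21:
  "(\<forall>e\<in>set gaps_21. 0 \<le> e) \<and> (89, 44) \<in> set (zip odd_primes_upto_250 gaps_21) \<and>
   10 ^ 9 * 65224 - 5 * 10 ^ 8 < sum_list (map2 (*) gaps_21 ln_table) \<and>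
   sum_list (map2 (*) gaps_21 ln_table) + 4500 * sum_list gaps_21 < 10 ^ 9 * 65224 + 5 * 10 ^ 8"
  by code_simp

lemma slack_21: "m_code 21 1 [1] 89 < row_code 21 1 1 89"
  by code_simp

definition gaps_25 :: "int list" where
  "gaps_25 = [809, 425, 288, 192, 136, 113, 101, 85, 73, 67, 72, 68, 66, 62, 53, 52, 52, 52, 52, 52,
     52, 52, 52, 52, 52, 52, 52, 50, 46, 32, 28, 22, 20, 10, 8, 2, 0, 0, 0, 0, 0, 0, 0, 0, 0,
     0, 0, 0, 0, 0, 0, 0]"

lemma gap_code_25: "map (gap_code 25 1 [0]) odd_primes_upto_250 = gaps_25"
  by code_simp

lemma gaps_25:
  "(\<forall>e\<in>set gaps_25. 0 \<le> e) \<and> (103, 52) \<in> set (zip odd_primes_upto_250 gaps_25) \<and>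
   10 ^ 9 * 93045 - 5 * 10 ^ 8 < sum_list (map2 (*) gaps_25 ln_table) \<and>
   sum_list (map2 (*) gaps_25 ln_table) + 4500 * sum_list gaps_25 < 10 ^ 9 * 93045 + 5 * 10 ^ 8"
  by code_simp

lemma slack_25: "m_code 25 1 [0] 103 < row_code 25 0 1 103"
  by code_simp

definition gaps_30 :: "int list" where
  "gaps_30 = [1109, 604, 395, 273, 204, 146, 141, 119, 99, 97, 79, 83, 86, 82, 76, 70, 67, 62, 62, 62,
     62, 62, 62, 62, 62, 62, 62, 62, 62, 62, 58, 52, 50, 40, 38, 32, 26, 22, 16, 10, 8, 0, 0,
     0, 0, 0, 0, 0, 0, 0, 0, 0]"

lemma gap_code_30: "map (gap_code 30 1 [1]) odd_primes_upto_250 = gaps_30"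
  by code_simp

lemma gaps_30:
  "(\<forall>e\<in>set gaps_30. 0 \<le> e) \<and> (127, 62) \<in> set (zip odd_primes_upto_250 gaps_30) \<and>
   10 ^ 9 * 135048 - 5 * 10 ^ 8 < sum_list (map2 (*) gaps_30 ln_table) \<and>
   sum_list (map2 (*) gaps_30 ln_table) + 4500 * sum_list gaps_30 < 10 ^ 9 * 135048 + 5 * 10 ^ 8"
  by code_simp

lemma slack_30: "m_code 30 1 [1] 127 < row_code 30 1 1 127"
  by code_simp

definition gaps_40 :: "int list" where
  "gaps_40 = [1901, 1006, 645, 442, 392, 246, 226, 192, 163, 157, 133, 130, 125, 113, 109, 113, 111,
     105, 101, 99, 93, 87, 84, 84, 84, 84, 84, 84, 84, 84, 84, 84, 84, 84, 84, 84, 84, 84, 78,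
     72, 70, 60, 58, 54, 52, 40, 28, 24, 22, 18, 12, 10]"

lemma gap_code_40: "map (gap_code 40 2 [0, 1]) odd_primes_upto_250 = gaps_40"
  by code_simp

lemma gaps_40:
  "(\<forall>e\<in>set gaps_40. 0 \<le> e) \<and> (83, 87) \<in> set (zip odd_primes_upto_250 gaps_40) \<and>
   10 ^ 9 * 250307 - 5 * 10 ^ 8 < sum_list (map2 (*) gaps_40 ln_table) \<and>
   sum_list (map2 (*) gaps_40 ln_table) + 4500 * sum_list gaps_40 < 10 ^ 9 * 250307 + 5 * 10 ^ 8"
  by code_simp

text \<open>
  The levels of \<open>41\<close> are excluded; there the comparison fails by one unit. At the level
  \<open>83\<close> it holds with one unit to spare.
\<close>
lemma pair_ok_40:
  "\<forall>p\<in>set odd_primes_upto_250. if p = 41 then True else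
    list_all (pair_ok 40 83) [p, p ^ 2, p ^ 3, p ^ 4, p ^ 5]"
  by code_simp

section \<open>The five instances\<close>

lemma denominator_bound_singleton:
  fixes B a p\<^sub>0 :: nat and c q V :: int
  assumes "1 \<le> B" "a \<le> 2" "2 * (NN B 1 + B) \<le> 250" "q \<noteq> 0"
    and es: "map (gap_code (int B) 1 [int a]) odd_primes_upto_250 = es"
    and cert: "(\<forall>e\<in>set es. 0 \<le> e) \<and> (int p\<^sub>0, e\<^sub>0) \<in> set (zip odd_primes_upto_250 es) \<and>
      10 ^ 9 * V - 5 * 10 ^ 8 < sum_list (map2 (*) es ln_table) \<and>
      sum_list (map2 (*) es ln_table) + 4500 * sum_list es < 10 ^ 9 * V + 5 * 10 ^ 8"
    and "e\<^sub>0 \<ge> 1"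
    and slack: "m_code (int B) 1 [int a] (int p\<^sub>0) < row_code (int B) (int a) 1 (int p\<^sub>0)"
  shows "denominator_bound_holds B 1 {a} (of_int V / 10) c q"
proof -
  have "int p\<^sub>0 \<in> set odd_primes_upto_250" using cert set_zip_leftD by fast
  then have "odd p\<^sub>0" unfolding int_mem_odd_primes_upto_250_iff by blast
  then have "padic_ge p ((\<Sum>\<nu> = 1..5. m_exp B 1 {a} (p ^ \<nu>)) + (if p = p\<^sub>0 then 1 else 0))
      (of_int q ^ 1 * poly (det (R_mat B 1 {a})) (of_int c / of_int q))" if "prime p" "odd p" for p
    using that assms by (intro padic_ge_det_single) auto
  then show ?thesis
    using assms denominator_bound_from_tables[of 1 "[a]" B es ln_table p\<^sub>0 e\<^sub>0 q c V]
      two_adic_det_R_mat(1)[OF assms(4)] ln_fix_table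
    by simp
qed

lemma denominator_bound_pair:
  fixes c q :: int
  assumes "q \<noteq> 0"
  shows "denominator_bound_holds 40 2 {0, 1} (of_int 250307 / 10) c q"
proof -
  have val: "padic_ge p ((\<Sum>\<nu> = 1..5. m_exp 40 2 {0, 1} (p ^ \<nu>)) + (if p = 83 then 1 else 0))
      (of_int q ^ 2 * poly (det (R_mat 40 2 {0, 1})) (of_int c / of_int q))"
    if p: "prime p" "odd p" for p
  proof (cases "p = 41")
    case True
    then show ?thesis using padic_ge_det_pair_41[OF assms(1)] by simp
  next
    case False
    have "pair_ok (int 40) (int 83) (int p ^ \<nu>)" if \<nu>: "\<nu> \<in> {1..5}" for \<nu>
    proof (cases "p \<le> 250")
      case True
      then have "int p \<in> set odd_primes_upto_250" using p int_mem_odd_primes_upto_250_iff by blast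
      then have "list_all (pair_ok 40 83) [int p, int p ^ 2, int p ^ 3, int p ^ 4, int p ^ 5]"
        using pair_ok_40 False by auto
      moreover have "\<nu> = 1 \<or> \<nu> = 2 \<or> \<nu> = 3 \<or> \<nu> = 4 \<or> \<nu> = 5" using \<nu> by auto
      ultimately show ?thesis by auto
    next
      case False
      have "int p \<le> int p ^ \<nu>"
        using \<nu> prime_gt_0_nat[OF p(1)] by (intro self_le_power) auto
      then have "int p ^ \<nu> > 250" using False by linarith
      then show ?thesis by (simp only: pair_ok_def if_P)
    qed
    then show ?thesis using p assms(1) by (intro padic_ge_det_pair) auto
  qed
  show ?thesis
    using denominator_bound_from_tables[of 2 "[0, 1]" 40 gaps_40 ln_table 83 87 q c 250307]
      gap_code_40 gaps_40 val two_adic_det_R_mat(2)[OF assms(1)] ln_fix_table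
    by (simp add: NN_def)
qed

theorem proposition3p4:
  fixes B S :: nat and A :: "nat set" and v :: real and a q :: int
  assumes "(B, S, A, v) \<in> {(20, 1, {0}, 5912.1), (21, 1, {1}, 6522.4), (25, 1, {0}, 9304.5),
                           (30, 1, {1}, 13504.8), (40, 2, {0, 1}, 25030.7)}"
    and "(a, q) \<in> {(1, 1), (1, 2)}"
  shows "(\<forall>p. prime p \<and> odd p \<longrightarrow>
            vp p (of_nat (Pi_prod B S)) - vp p (of_nat (F_fac (2 * B))) = ereal (a_total B S p))
       \<and> (\<forall>p. prime p \<and> odd p \<longrightarrow>
            vp p (of_int q ^ S * poly (det (R_mat B S A)) (of_int a / of_int q))
              \<ge> ereal (m_total B S A p))
       \<and> real_of_int (round (10 * B_bound B S A)) / 10 = v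
       \<and> B_bound B S A > ln (real_of_int (den (of_int q ^ S * poly (q_hat B S A) (of_int a / of_int q))))
       \<and> v > ln (real_of_int (den (of_int q ^ S * poly (q_hat B S A) (of_int a / of_int q))))
       \<and> int (H_min B S A a q) = den (of_int q ^ S * poly (q_hat B S A) (of_int a / of_int q))
       \<and> ln (real (H_min B S A a q)) \<le> B_bound B S A"
proof -
  have q: "q \<noteq> 0" using assms(2) by auto
  consider "B = 20" "S = 1" "A = {0}" "v = of_int 59121 / 10"
    | "B = 21" "S = 1" "A = {1}" "v = of_int 65224 / 10"
    | "B = 25" "S = 1" "A = {0}" "v = of_int 93045 / 10"
    | "B = 30" "S = 1" "A = {1}" "v = of_int 135048 / 10"
    | "B = 40" "S = 2" "A = {0, 1}" "v = of_int 250307 / 10"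
    using assms(1) by auto
  then have "denominator_bound_holds B S A v a q"
  proof cases
    case 1
    show ?thesis
      using denominator_bound_singleton[of 20 0 q gaps_20 83 42 59121 a] q gap_code_20 gaps_20 slack_20
      unfolding 1 by (simp add: NN_def)
  next
    case 2
    show ?thesis
      using denominator_bound_singleton[of 21 1 q gaps_21 89 44 65224 a] q gap_code_21 gaps_21 slack_21
      unfolding 2 by (simp add: NN_def)
  next
    case 3
    show ?thesis
      using denominator_bound_singleton[of 25 0 q gaps_25 103 52 93045 a] q gap_code_25 gaps_25 slack_25
      unfolding 3 by (simp add: NN_def)
  next
    case 4
    show ?thesis
      using denominator_bound_singleton[of 30 1 q gaps_30 127 62 135048 a] q gap_code_30 gaps_30 slack_30
      unfolding 4 by (simp add: NN_def)
  next
    case 5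
    show ?thesis unfolding 5 by (rule denominator_bound_pair[OF q])
  qed
  then show ?thesis unfolding denominator_bound_holds_def .
qed

end
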